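(* Let $x$ and $y$ be elements in $\mathrm{Cu}(C[0,1])$, and let $f_x$ and $f_y$ be the functions in $\mathrm{Lsc}([0,1],\overline{\mathbb{N}})$ associated with $x$ and $y$, respectively. The following are equivalent: (1) $x\ll y$. (2) For all $t \in [0,1]$, there exist an open interval $U_t$ around $t$ and $c_t \in \overline{\mathbb{N}}$ such that $f_x(s) \leq c_t \leq f_y(s)$ for all $s\in U_t$. (3) There exists a continuous function $g: [0,1] \to [0,\infty)$ such that $f_x(t) \leq g(t) \leq f_y(t)$ for all $t \in [0,1]$. If, moreover, either $x$ or $y$ is compact in $\mathrm{Cu}(C[0,1])$, then $x\ll y$ if and only if $f_x \leq f_y$. Finally, if $y$ is noncompact, then $x\ll y$ implies that there are a continuous function $g$ as in (3) and a nonempty open interval $U \subset [0,1]$ such that $f_x(t) \leq g(t) < f_y(t)$ for all $t \in U$.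
   Context: For a C$^*$-algebra $B$ and positive elements $a,b\in (B\otimes\mathcal{K})_+$ ($\mathcal{K}$ = compact operators on a separable infinite-dimensional Hilbert space), $a\precsim b$ means there is a sequence $(r_n)$ in $B\otimes\mathcal{K}$ with $\|r_n b r_n^*-a\|\to 0$; $a\sim b$ means $a\precsim b$ and $b\precsim a$. The Cuntz semigroup is $\mathrm{Cu}(B)=(B\otimes\mathcal{K})_+/\!\sim$, with class $[a]$, order $[a]\le[b]$ iff $a\precsim b$, and addition $[a]+[b]=[a\oplus b]$. Every increasing sequence in $\mathrm{Cu}(B)$ has a supremum. Compact containment: $x\ll y$ means that whenever $(z_n)$ is an increasing sequence with supremum $z\ge y$, there is $n_0$ with $x\le z_{n_0}$. An element $x$ is compact if $x\ll x$, and noncompact otherwise. $\overline{\mathbb{N}}=\{0,1,2,\dots\}\cup\{\infty\}$, and $\mathrm{Lsc}([0,1],\overline{\mathbb{N}})$ is the set of lower semicontinuous functions $[0,1]\to\overline{\mathbb{N}}$ with pointwise order and addition. Elements of $(C[0,1]\otimes\mathcal{K})_+$ are regarded as continuous functions $a:[0,1]\to\mathcal{K}_+$. The map $\theta([a])(t)=\mathrm{rank}(a(t))$ is a well-defined order and semigroup isomorphism from $\mathrm{Cu}(C[0,1])$ onto $\mathrm{Lsc}([0,1],\overline{\mathbb{N}})$; the function associated with $x$ is the rank function $f_x=\theta(x)$. Open intervals are understood relative to $[0,1]$.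
   Formalization: In (2) the formal statement takes c_t to be a finite natural number instead of an element of N ∪ {∞}; with c_t = ∞ allowed the claim fails, e.g. for x = y with f_x = f_y = ∞, where (2) holds but (1) and (3) do not. *)

theory Defs
  imports "HOL-Analysis.Analysis"
begin

section \<open>The complex Hilbert space of square-summable sequences\<close>

lemma summable_sq_add:
  fixes f g :: "nat \<Rightarrow> complex"
  assumes "summable (\<lambda>n. (cmod (f n))\<^sup>2)" "summable (\<lambda>n. (cmod (g n))\<^sup>2)"
  shows "summable (\<lambda>n. (cmod (f n + g n))\<^sup>2)"
proof (rule summable_comparison_test')
  show "summable (\<lambda>n. 2 * (cmod (f n))\<^sup>2 + 2 * (cmod (g n))\<^sup>2)"
    using assms by (intro summable_add summable_mult)
  fix n :: nat
  have "(cmod (f n + g n))\<^sup>2 \<le> (cmod (f n) + cmod (g n))\<^sup>2"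
    by (intro power_mono norm_triangle_ineq) auto
  also have "\<dots> \<le> 2 * (cmod (f n))\<^sup>2 + 2 * (cmod (g n))\<^sup>2"
    using sum_squares_bound[of "cmod (f n)" "cmod (g n)"] by (simp add: power2_sum)
  finally show "norm ((cmod (f n + g n))\<^sup>2) \<le> 2 * (cmod (f n))\<^sup>2 + 2 * (cmod (g n))\<^sup>2"
    by simp
qed

lemma summable_cnj_mult:
  fixes f g :: "nat \<Rightarrow> complex"
  assumes "summable (\<lambda>n. (cmod (f n))\<^sup>2)" "summable (\<lambda>n. (cmod (g n))\<^sup>2)"
  shows "summable (\<lambda>n. cnj (f n) * g n)"
proof (rule summable_comparison_test')
  show "summable (\<lambda>n. (cmod (f n))\<^sup>2 + (cmod (g n))\<^sup>2)"
    using assms by (intro summable_add)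
  fix n :: nat
  have "cmod (f n) * cmod (g n) \<le> 2 * cmod (f n) * cmod (g n)"
    by simp
  also have "\<dots> \<le> (cmod (f n))\<^sup>2 + (cmod (g n))\<^sup>2"
    by (rule sum_squares_bound)
  finally show "norm (cnj (f n) * g n) \<le> (cmod (f n))\<^sup>2 + (cmod (g n))\<^sup>2"
    by (simp add: norm_mult)
qed

typedef ell2 = "{f :: nat \<Rightarrow> complex. summable (\<lambda>n. (cmod (f n))\<^sup>2)}"
  by (rule exI[of _ "\<lambda>_. 0"]) simp

setup_lifting type_definition_ell2

lift_definition scaleC :: "complex \<Rightarrow> ell2 \<Rightarrow> ell2" (infixr \<open>*\<^sub>C\<close> 75)
  is "\<lambda>c f n. c * f n"
  by (simp add: norm_mult power_mult_distrib summable_mult)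

lift_definition cinner :: "ell2 \<Rightarrow> ell2 \<Rightarrow> complex"
  is "\<lambda>f g. \<Sum>n. cnj (f n) * g n" .

text \<open>The real inner product is the real part of the complex one, so that the norm is the
  usual norm of \<open>ell2\<close>, and the norm of a real-linear bounded operator that happens to be
  complex-linear is its usual operator norm.\<close>

instantiation ell2 :: real_inner
begin

lift_definition zero_ell2 :: ell2 is "\<lambda>_. 0" by simp

lift_definition plus_ell2 :: "ell2 \<Rightarrow> ell2 \<Rightarrow> ell2" is "\<lambda>f g n. f n + g n"
  by (rule summable_sq_add)

lift_definition uminus_ell2 :: "ell2 \<Rightarrow> ell2" is "\<lambda>f n. - f n" by simp

definition minus_ell2 :: "ell2 \<Rightarrow> ell2 \<Rightarrow> ell2" where "minus_ell2 u v = u + - v"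

definition scaleR_ell2 :: "real \<Rightarrow> ell2 \<Rightarrow> ell2" where "scaleR_ell2 r u = of_real r *\<^sub>C u"

definition inner_ell2 :: "ell2 \<Rightarrow> ell2 \<Rightarrow> real" where "inner_ell2 u v = Re (cinner u v)"

definition norm_ell2 :: "ell2 \<Rightarrow> real" where "norm_ell2 u = sqrt (u \<bullet> u)"

definition dist_ell2 :: "ell2 \<Rightarrow> ell2 \<Rightarrow> real" where "dist_ell2 u v = norm (u - v)"

definition sgn_ell2 :: "ell2 \<Rightarrow> ell2" where "sgn_ell2 u = inverse (norm u) *\<^sub>R u"

definition uniformity_ell2 :: "(ell2 \<times> ell2) filter"
  where "uniformity_ell2 = (INF e\<in>{0<..}. principal {(u, v). dist u v < e})"

definition open_ell2 :: "ell2 set \<Rightarrow> bool"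
  where "open_ell2 U = (\<forall>u\<in>U. eventually (\<lambda>(u', v). u' = u \<longrightarrow> v \<in> U) uniformity)"

instance
proof
  fix u v w :: ell2 and r s :: real and U :: "ell2 set"
  show "u + v + w = u + (v + w)" by transfer (simp add: add.assoc)
  show "u + v = v + u" by transfer (simp add: add.commute)
  show "0 + u = u" by transfer simp
  show "- u + u = 0" by transfer simp
  show "u - v = u + - v" by (rule minus_ell2_def)
  show "r *\<^sub>R (u + v) = r *\<^sub>R u + r *\<^sub>R v"
    unfolding scaleR_ell2_def by transfer (simp add: algebra_simps)
  show "(r + s) *\<^sub>R u = r *\<^sub>R u + s *\<^sub>R u"
    unfolding scaleR_ell2_def by transfer (simp add: algebra_simps)
  show "r *\<^sub>R s *\<^sub>R u = (r * s) *\<^sub>R u"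
    unfolding scaleR_ell2_def by transfer (simp add: algebra_simps)
  show "1 *\<^sub>R u = u"
    unfolding scaleR_ell2_def by transfer simp
  show "dist u v = norm (u - v)" by (rule dist_ell2_def)
  show "sgn u = inverse (norm u) *\<^sub>R u" by (rule sgn_ell2_def)
  show "uniformity = (INF e\<in>{0<..}. principal {(u :: ell2, v). dist u v < e})"
    by (rule uniformity_ell2_def)
  show "open U = (\<forall>u\<in>U. \<forall>\<^sub>F (u', v) in uniformity. u' = u \<longrightarrow> v \<in> U)"
    by (rule open_ell2_def)
  show "norm u = sqrt (u \<bullet> u)" by (rule norm_ell2_def)
  have re: "Re (\<Sum>n. h n) = (\<Sum>n. Re (h n))" if "summable h" for h :: "nat \<Rightarrow> complex"
    using bounded_linear.suminf[OF bounded_linear_Re that] .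
  show "u \<bullet> v = v \<bullet> u"
    unfolding inner_ell2_def
    by transfer (simp add: re summable_cnj_mult, simp add: mult.commute)
  show "(u + v) \<bullet> w = u \<bullet> w + v \<bullet> w"
    unfolding inner_ell2_def
    by transfer (simp add: distrib_right suminf_add[symmetric] summable_cnj_mult)
  show "r *\<^sub>R u \<bullet> v = r * (u \<bullet> v)"
    unfolding inner_ell2_def scaleR_ell2_def
  proof transfer
    fix r :: real and f g :: "nat \<Rightarrow> complex"
    assume "summable (\<lambda>n. (cmod (f n))\<^sup>2)" "summable (\<lambda>n. (cmod (g n))\<^sup>2)"
    then have "summable (\<lambda>n. cnj (f n) * g n)" by (rule summable_cnj_mult)
    then show "Re (\<Sum>n. cnj (of_real r * f n) * g n) = r * Re (\<Sum>n. cnj (f n) * g n)"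
      by (simp add: mult.assoc suminf_mult)
  qed
  have sq: "Re (\<Sum>n. cnj (f n) * f n) = (\<Sum>n. (cmod (f n))\<^sup>2)"
    if "summable (\<lambda>n. (cmod (f n))\<^sup>2)" for f :: "nat \<Rightarrow> complex"
  proof -
    have "Re (\<Sum>n. cnj (f n) * f n) = (\<Sum>n. Re (cnj (f n) * f n))"
      by (rule re) (rule summable_cnj_mult[OF that that])
    also have "(\<lambda>n. Re (cnj (f n) * f n)) = (\<lambda>n. (cmod (f n))\<^sup>2)"
      by (simp add: fun_eq_iff cmod_power2) (simp add: power2_eq_square)
    finally show ?thesis .
  qed
  show "0 \<le> u \<bullet> u"
    unfolding inner_ell2_def by transfer (simp add: sq suminf_nonneg)
  show "(u \<bullet> u = 0) = (u = 0)"
    unfolding inner_ell2_def by transfer (simp add: sq suminf_eq_zero_iff fun_eq_iff)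
qed

end

global_interpretation ell2: vector_space scaleC
  by unfold_locales (transfer, simp add: algebra_simps)+


section \<open>Compact operators\<close>

type_synonym operator = "ell2 \<Rightarrow>\<^sub>L ell2"

definition compact_operators :: "operator set" where
  "compact_operators =
     {T. (\<forall>c u. blinfun_apply T (c *\<^sub>C u) = c *\<^sub>C blinfun_apply T u) \<and>
         compact (closure (blinfun_apply T ` cball 0 1))}"

definition positive_operator :: "operator \<Rightarrow> bool" where
  "positive_operator T \<longleftrightarrow> (\<forall>u. cinner u (blinfun_apply T u) \<in> \<real>\<^sub>\<ge>\<^sub>0)"

definition adjoint_operator :: "operator \<Rightarrow> operator" where
  "adjoint_operator T =
     (THE S. \<forall>u v. cinner (blinfun_apply T u) v = cinner u (blinfun_apply S v))"

text \<open>The complex dimension of the range; \<open>ell2.dim\<close> alone would not distinguish infinite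
  dimension from dimension 0.\<close>

definition operator_rank :: "operator \<Rightarrow> enat" where
  "operator_rank T =
     (if \<exists>B. finite B \<and> range (blinfun_apply T) \<subseteq> ell2.span B then enat (ell2.dim (range (blinfun_apply T))) else \<infinity>)"


section \<open>The Cuntz semigroup of \<open>C[0,1]\<close>\<close>

text \<open>\<open>C[0,1] \<otimes> \<K>\<close> is \<open>C([0,1], \<K>)\<close> with the supremum norm and pointwise operations.
  Its elements are represented by total functions on the reals, whose values outside
  \<open>[0,1]\<close> are irrelevant: two functions that agree on \<open>[0,1]\<close> are Cuntz equivalent.\<close>

definition CK :: "(real \<Rightarrow> operator) set" where
  "CK = {a. continuous_on {0..1} a \<and> a ` {0..1} \<subseteq> compact_operators}"

definition CK_pos :: "(real \<Rightarrow> operator) set" where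
  "CK_pos = {a \<in> CK. \<forall>t\<in>{0..1}. positive_operator (a t)}"

definition cuntz_le :: "(real \<Rightarrow> operator) \<Rightarrow> (real \<Rightarrow> operator) \<Rightarrow> bool" (infix \<open>\<precsim>\<close> 50) where
  "a \<precsim> b \<longleftrightarrow> (\<exists>r :: nat \<Rightarrow> real \<Rightarrow> operator. (\<forall>n. r n \<in> CK) \<and>
     uniform_limit {0..1} (\<lambda>n t. r n t o\<^sub>L b t o\<^sub>L adjoint_operator (r n t)) a sequentially)"

definition cuntz_rel :: "((real \<Rightarrow> operator) \<times> (real \<Rightarrow> operator)) set" where
  "cuntz_rel = {(a, b). a \<in> CK_pos \<and> b \<in> CK_pos \<and> a \<precsim> b \<and> b \<precsim> a}"

type_synonym cuntz_class = "(real \<Rightarrow> operator) set"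

definition Cu :: "cuntz_class set" where
  "Cu = CK_pos // cuntz_rel"

definition Cu_le :: "cuntz_class \<Rightarrow> cuntz_class \<Rightarrow> bool" (infix \<open>\<le>\<^sub>C\<^sub>u\<close> 50) where
  "x \<le>\<^sub>C\<^sub>u y \<longleftrightarrow> (\<exists>a\<in>x. \<exists>b\<in>y. a \<precsim> b)"

definition Cu_increasing :: "(nat \<Rightarrow> cuntz_class) \<Rightarrow> bool" where
  "Cu_increasing z \<longleftrightarrow> (\<forall>n. z n \<in> Cu) \<and> (\<forall>n. z n \<le>\<^sub>C\<^sub>u z (Suc n))"

definition Cu_is_sup :: "(nat \<Rightarrow> cuntz_class) \<Rightarrow> cuntz_class \<Rightarrow> bool" where
  "Cu_is_sup z s \<longleftrightarrow> s \<in> Cu \<and> (\<forall>n. z n \<le>\<^sub>C\<^sub>u s) \<and>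
     (\<forall>w\<in>Cu. (\<forall>n. z n \<le>\<^sub>C\<^sub>u w) \<longrightarrow> s \<le>\<^sub>C\<^sub>u w)"

definition Cu_way_below :: "cuntz_class \<Rightarrow> cuntz_class \<Rightarrow> bool" (infix \<open>\<lless>\<close> 50) where
  "x \<lless> y \<longleftrightarrow>
     (\<forall>z s. Cu_increasing z \<and> Cu_is_sup z s \<and> y \<le>\<^sub>C\<^sub>u s \<longrightarrow> (\<exists>n. x \<le>\<^sub>C\<^sub>u z n))"

definition Cu_compact :: "cuntz_class \<Rightarrow> bool" where
  "Cu_compact x \<longleftrightarrow> x \<lless> x"

text \<open>The rank function \<open>f\<^sub>x = \<theta>(x)\<close>: the common value of \<open>rank (a(t))\<close> over all
  representatives \<open>a\<close> of \<open>x\<close>.  Only its values on \<open>[0,1]\<close> are meaningful.\<close>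

definition rank_fun :: "cuntz_class \<Rightarrow> real \<Rightarrow> enat" where
  "rank_fun x t = the_elem ((\<lambda>a. operator_rank (a t)) ` x)"


section \<open>Intervals and interpolating functions\<close>

definition rel_open_interval :: "real set \<Rightarrow> bool" where
  "rel_open_interval U \<longleftrightarrow> (\<exists>a b. U = {a<..<b} \<inter> {0..1})"

definition cont_interpolates :: "(real \<Rightarrow> enat) \<Rightarrow> (real \<Rightarrow> real) \<Rightarrow> (real \<Rightarrow> enat) \<Rightarrow> bool" where
  "cont_interpolates f g h \<longleftrightarrow> continuous_on {0..1} g \<and> (\<forall>t\<in>{0..1}. 0 \<le> g t) \<and>
     (\<forall>t\<in>{0..1}. ereal_of_enat (f t) \<le> ereal (g t) \<and> ereal (g t) \<le> ereal_of_enat (h t))"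

end

theory Submission
  imports Defs
begin

text \<open>
  For \<open>a, b\<close> in \<open>(C[0,1] \<otimes> \<K>)\<^sub>+\<close> one has \<open>a \<precsim> b\<close> iff \<open>rank a(t) \<le> rank b(t)\<close> for all \<open>t\<close>, so the
  order of the Cuntz semigroup is read off from rank functions.  If \<open>r = \<Sum>\<^sub>i e\<^sub>i \<rho>\<^sub>i\<^sup>*\<close>, then \<open>r b r\<^sup>*\<close>
  is the Gram matrix of the tuple \<open>\<rho>\<close> for the form \<open>\<langle>u, b v\<rangle>\<close>; hence one looks for a continuous
  family of tuples whose Gram matrix for \<open>b(t)\<close> is close to a corner of \<open>a(t)\<close>.  Solutions exist
  pointwise by Gram-Schmidt and persist on short intervals.  They can be glued because two tuples
  with Gram matrices close to the same matrix are joined by a path of tuples with this property: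
  rotate one of them by complex reflections until it is nearly in optimal position with respect to
  the other one, and then use the straight line.

  An increasing sequence with supremum \<open>y\<close> is given by diagonal operators with entries
  \<open>max 0 (dist (t, {f\<^sub>y \<le> k}) - 1/n)\<close>; if \<open>x \<lless> y\<close>, then \<open>x\<close> lies below one of them, and truncated
  multiples of the distances add up to the interpolating function.  Conversely, rank functions of
  an increasing sequence exhaust the rank function of its supremum at each point, as one sees by
  testing with an element that has a prescribed finite rank at this point and infinite rank
  elsewhere; compactness of the interval then gives \<open>x \<lless> y\<close> from (2).  In the last claim any \<open>g\<close>
  works, since \<open>g = f\<^sub>y\<close> would make \<open>y\<close> compact.
\<close>

section \<open>The Hilbert space and positive forms\<close>

lemma cinner_add_left: "cinner (u + v) w = cinner u w + cinner v w"
  by transfer (simp add: distrib_right suminf_add[symmetric] summable_cnj_mult)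

lemma cinner_add_right: "cinner w (u + v) = cinner w u + cinner w v"
  by transfer (simp add: distrib_left suminf_add[symmetric] summable_cnj_mult)

lemma cinner_scaleC_left: "cinner (c *\<^sub>C u) v = cnj c * cinner u v"
  by transfer (simp add: mult.assoc suminf_mult summable_cnj_mult)

lemma cinner_scaleC_right: "cinner u (c *\<^sub>C v) = c * cinner u v"
  by transfer (simp add: mult.left_commute suminf_mult summable_cnj_mult)

lemma cinner_self: "cinner u u = of_real ((norm u)\<^sup>2)"
proof -
  have "Im (cinner u u) = 0"
  proof transfer
    fix f :: "nat \<Rightarrow> complex" assume "summable (\<lambda>n. (cmod (f n))\<^sup>2)"
    then have "summable (\<lambda>n. cnj (f n) * f n)" by (intro summable_cnj_mult)
    from bounded_linear.suminf[OF bounded_linear_Im this]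
    show "Im (\<Sum>n. cnj (f n) * f n) = 0" by (simp add: mult.commute)
  qed
  moreover have "Re (cinner u u) = (norm u)\<^sup>2"
    by (simp add: power2_norm_eq_inner inner_ell2_def)
  ultimately show ?thesis by (simp add: complex_eq_iff)
qed

lemma scaleC_of_real: "of_real r *\<^sub>C u = r *\<^sub>R u"
  by (simp add: scaleR_ell2_def)

section \<open>Positive semidefinite sesquilinear forms\<close>

locale psd_form =
  fixes B :: "ell2 \<Rightarrow> ell2 \<Rightarrow> complex"
  assumes add_left: "B (u + v) w = B u w + B v w"
    and add_right: "B w (u + v) = B w u + B w v"
    and scale_left: "B (c *\<^sub>C u) v = cnj c * B u v"
    and scale_right: "B u (c *\<^sub>C v) = c * B u v"
    and Im_diag: "Im (B v v) = 0"
    and Re_diag: "0 \<le> Re (B v v)"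
begin

lemma zero_left [simp]: "B 0 v = 0"
  using scale_left[of 0 0 v] by (metis ell2.scale_zero_left complex_cnj_zero mult_zero_left)

lemma zero_right [simp]: "B v 0 = 0"
  using scale_right[of v 0 0] by (metis ell2.scale_zero_left mult_zero_left)

lemma minus_left: "B (- u) v = - B u v"
  using add_left[of u "-u" v] by (simp add: eq_neg_iff_add_eq_0 add.commute)

lemma minus_right: "B v (- u) = - B v u"
  using add_right[of v u "-u"] by (simp add: eq_neg_iff_add_eq_0 add.commute)

lemma diff_left: "B (u - v) w = B u w - B v w"
  using add_left[of u "-v" w] by (simp add: minus_left)

lemma diff_right: "B w (u - v) = B w u - B w v"
  using add_right[of w u "-v"] by (simp add: minus_right)

lemma sum_left: "B (\<Sum>i\<in>I. f i) w = (\<Sum>i\<in>I. B (f i) w)"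
  by (induction I rule: infinite_finite_induct) (auto simp: add_left)

lemma sum_right: "B w (\<Sum>i\<in>I. f i) = (\<Sum>i\<in>I. B w (f i))"
  by (induction I rule: infinite_finite_induct) (auto simp: add_right)

lemma scaleR_left: "B (r *\<^sub>R u) w = of_real r * B u w"
  using scale_left[of "of_real r" u w] by (simp add: scaleC_of_real)

lemma scaleR_right: "B w (r *\<^sub>R u) = of_real r * B w u"
  using scale_right[of w "of_real r" u] by (simp add: scaleC_of_real)

text \<open>Polarisation: reality of the diagonal at \<open>u + v\<close> and at
  \<open>u + \<i> *\<^sub>C v\<close> fixes the imaginary and the real part of \<open>B v u\<close>
  in terms of \<open>B u v\<close>.\<close>

lemma hermitian: "B v u = cnj (B u v)"
proof -
  have "Im (B (u + v) (u + v)) = 0" "Im (B (u + \<i> *\<^sub>C v) (u + \<i> *\<^sub>C v)) = 0"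
    by (rule Im_diag)+
  then show ?thesis
    by (simp add: add_left add_right scale_left scale_right Im_diag complex_eq_iff)
qed

definition Q :: "ell2 \<Rightarrow> real" where "Q u = Re (B u u)"

lemma Q_nonneg [simp]: "0 \<le> Q u"
  by (simp add: Q_def Re_diag)

lemma B_diag: "B u u = of_real (Q u)"
  by (simp add: Q_def complex_eq_iff Im_diag)

lemma Q_scale: "Q (c *\<^sub>C u) = (cmod c)\<^sup>2 * Q u"
proof -
  have "B (c *\<^sub>C u) (c *\<^sub>C u) = (c * cnj c) * B u u"
    by (simp add: scale_left scale_right mult_ac)
  then have "of_real (Q (c *\<^sub>C u)) = (of_real ((cmod c)\<^sup>2 * Q u) :: complex)"
    by (simp add: B_diag complex_norm_square[symmetric])
  then show ?thesis using of_real_eq_iff by blast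
qed

lemma cauchy_schwarz: "(cmod (B u v))\<^sup>2 \<le> Q u * Q v"
proof -
  have ineq: "0 \<le> Q u + 2 * Re (c * B u v) + (cmod c)\<^sup>2 * Q v" for c
  proof -
    have "Q (u + c *\<^sub>C v) = Q u + 2 * Re (c * B u v) + Q (c *\<^sub>C v)"
      using hermitian[of v u] unfolding Q_def
      by (simp add: add_left add_right scale_left scale_right algebra_simps)
    then show ?thesis using Q_nonneg[of "u + c *\<^sub>C v"] by (simp add: Q_scale)
  qed
  \<comment> \<open>The phase of \<open>c\<close> makes the linear term real and leaves a real
    quadratic in \<open>r\<close>.\<close>
  have *: "0 \<le> Q u - 2 * r * (cmod (B u v))\<^sup>2 + r\<^sup>2 * (cmod (B u v))\<^sup>2 * Q v" for r
  proof -
    have "(- of_real r * cnj (B u v)) * B u v = - of_real (r * (cmod (B u v))\<^sup>2)"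
      using complex_norm_square[of "B u v"] by (simp add: mult_ac)
    then have "Re ((- of_real r * cnj (B u v)) * B u v) = - r * (cmod (B u v))\<^sup>2"
      by (metis Re_complex_of_real minus_complex.sel(1) mult_minus_left uminus_complex.sel(1))
    with ineq[of "- of_real r * cnj (B u v)"] show ?thesis
      by (simp add: norm_mult power_mult_distrib)
  qed
  show ?thesis
  proof (cases "Q v = 0")
    case True
    have "(cmod (B u v))\<^sup>2 = 0"
    proof (rule ccontr)
      assume "(cmod (B u v))\<^sup>2 \<noteq> 0"
      \<comment> \<open>When \<open>Q v = 0\<close> the bound is affine in \<open>r\<close>; at this
        value its right-hand side is -1.\<close>
      then show False using *[of "(Q u + 1) / (2 * (cmod (B u v))\<^sup>2)"] True by simp
    qed
    then show ?thesis using True by simp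
  next
    case False
    then have pos: "Q v > 0" using Q_nonneg[of v] by linarith
    \<comment> \<open>\<open>r = 1 / Q v\<close> minimises the quadratic.\<close>
    have "0 \<le> Q u - (cmod (B u v))\<^sup>2 / Q v"
      using *[of "1 / Q v"] pos by (simp add: power2_eq_square divide_simps)
    then show ?thesis using pos by (simp add: field_simps)
  qed
qed

lemma Q_zero_left: "Q u = 0 \<Longrightarrow> B u v = 0"
  using cauchy_schwarz[of u v] by simp

lemma Q_zero_right: "Q v = 0 \<Longrightarrow> B u v = 0"
  using cauchy_schwarz[of u v] by simp

lemma parallelogram: "Q (u + v) + Q (u - v) = 2 * Q u + 2 * Q v"
  unfolding Q_def by (simp add: add_left add_right diff_left diff_right)

lemma Q_i [simp]: "Q (\<i> *\<^sub>C v) = Q v"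
  by (simp add: Q_scale)

lemma cmod_B_le: "cmod (B u v) \<le> (Q u + Q v) / 2"
proof -
  have "cmod (B u v) \<le> sqrt (Q u * Q v)"
    using cauchy_schwarz by (simp add: real_le_rsqrt)
  also have "\<dots> \<le> (Q u + Q v) / 2" by (rule arith_geo_mean_sqrt) auto
  finally show ?thesis .
qed

end

interpretation cinner: psd_form cinner
  by unfold_locales
    (auto simp: cinner_add_left cinner_add_right cinner_scaleC_left cinner_scaleC_right cinner_self
      simp flip: of_real_power)

lemma cinner_Q: "cinner.Q u = (norm u)\<^sup>2"
  by (simp only: cinner.Q_def cinner_self Re_complex_of_real)

lemma cmod_cinner_le: "cmod (cinner u v) \<le> norm u * norm v"
proof (rule power2_le_imp_le)
  show "(cmod (cinner u v))\<^sup>2 \<le> (norm u * norm v)\<^sup>2"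
    using cinner.cauchy_schwarz[of u v] by (simp only: cinner_Q power_mult_distrib)
qed simp

lemma norm_scaleC: "norm (c *\<^sub>C u) = cmod c * norm u"
proof (rule power2_eq_imp_eq)
  show "(norm (c *\<^sub>C u))\<^sup>2 = (cmod c * norm u)\<^sup>2"
    using cinner.Q_scale[of c u] by (simp only: cinner_Q power_mult_distrib)
qed auto

lemma scaleC_scaleR_comm: "c *\<^sub>C (r *\<^sub>R u) = r *\<^sub>R (c *\<^sub>C u)"
  by (simp add: scaleR_ell2_def mult.commute)

lemma bounded_bilinear_cinner: "bounded_bilinear cinner"
proof
  show "\<exists>K. \<forall>a b. norm (cinner a b) \<le> norm a * norm b * K"
    using cmod_cinner_le by (intro exI[of _ 1]) simp
qed (auto simp: cinner_add_left cinner_add_right cinner.scaleR_left cinner.scaleR_right scaleR_conv_of_real)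

lemma bounded_bilinear_scaleC: "bounded_bilinear scaleC"
proof
  show "\<exists>K. \<forall>a b. norm (a *\<^sub>C b) \<le> norm a * norm b * K"
    using norm_scaleC by (intro exI[of _ 1]) simp
qed (auto simp: ell2.scale_left_distrib ell2.scale_right_distrib scaleC_scaleR_comm
       scaleR_ell2_def scaleR_conv_of_real)

lemmas continuous_on_cinner = bounded_bilinear.continuous_on[OF bounded_bilinear_cinner]
  and continuous_on_scaleC = bounded_bilinear.continuous_on[OF bounded_bilinear_scaleC]

section \<open>Coordinates with respect to the standard basis\<close>

lift_definition ket :: "nat \<Rightarrow> ell2" is "\<lambda>k n. if n = k then 1 else 0"
  by (rule summable_finite[of "{_}"]) auto

lemma cinner_ket_left: "cinner (ket k) u = Rep_ell2 u k"
proof transfer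
  fix k and f :: "nat \<Rightarrow> complex"
  have "(\<Sum>n. cnj (if n = k then 1 else 0) * f n) = (\<Sum>n\<in>{k}. cnj (if n = k then 1 else 0) * f n)"
    by (rule suminf_finite) auto
  then show "(\<Sum>n. cnj (if n = k then 1 else 0) * f n) = f k" by simp
qed

lemma cinner_ket_ket: "cinner (ket i) (ket j) = (if i = j then 1 else 0)"
  by (simp add: cinner_ket_left ket.rep_eq)

lemma norm_ket [simp]: "norm (ket k) = 1"
  by (simp add: norm_eq_sqrt_inner inner_ell2_def cinner_ket_ket)

lemma ell2_eqI: "(\<And>k. cinner (ket k) u = cinner (ket k) v) \<Longrightarrow> u = v"
  by (simp add: cinner_ket_left Rep_ell2_inject[symmetric] fun_eq_iff)

lemma norm_ell2_sq: "(norm u)\<^sup>2 = (\<Sum>n. (cmod (cinner (ket n) u))\<^sup>2)"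
  and summable_ell2: "summable (\<lambda>n. (cmod (cinner (ket n) u))\<^sup>2)"
proof -
  show s: "summable (\<lambda>n. (cmod (cinner (ket n) u))\<^sup>2)"
    unfolding cinner_ket_left using Rep_ell2[of u] by simp
  then have s': "summable (\<lambda>n. cnj (Rep_ell2 u n) * Rep_ell2 u n)"
    unfolding cinner_ket_left by (intro summable_cnj_mult)
  have "(norm u)\<^sup>2 = Re (cinner u u)" by (simp only: cinner_self Re_complex_of_real)
  also have "\<dots> = Re (\<Sum>n. cnj (Rep_ell2 u n) * Rep_ell2 u n)" by (simp add: cinner.rep_eq)
  also have "\<dots> = (\<Sum>n. Re (cnj (Rep_ell2 u n) * Rep_ell2 u n))"
    by (rule bounded_linear.suminf[OF bounded_linear_Re s'])
  also have "\<dots> = (\<Sum>n. (cmod (cinner (ket n) u))\<^sup>2)"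
    by (simp add: cmod_power2 cinner_ket_left) (simp add: power2_eq_square)
  finally show "(norm u)\<^sup>2 = (\<Sum>n. (cmod (cinner (ket n) u))\<^sup>2)" .
qed

lemma cinner_ket_sum:
  "cinner (ket k) (\<Sum>i<n. c i *\<^sub>C ket i) = (if k < n then c k else 0)"
  by (auto simp: cinner.sum_right cinner_scaleC_right cinner_ket_ket if_distrib cong: if_cong)

text \<open>The squared error is a tail of the convergent series in
  \<open>norm_ell2_sq\<close>.\<close>

lemma ket_expansion: "(\<lambda>n. \<Sum>i<n. cinner (ket i) u *\<^sub>C ket i) \<longlonglongrightarrow> u"
proof -
  have "(norm (u - (\<Sum>i<n. cinner (ket i) u *\<^sub>C ket i)))\<^sup>2 = (\<Sum>k. (cmod (cinner (ket (k + n)) u))\<^sup>2)" for n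
  proof -
    let ?w = "u - (\<Sum>i<n. cinner (ket i) u *\<^sub>C ket i)"
    have c: "cinner (ket k) ?w = (if k < n then 0 else cinner (ket k) u)" for k
      by (simp add: cinner.diff_right cinner_ket_sum)
    have "(norm ?w)\<^sup>2 = (\<Sum>k. (cmod (cinner (ket (k + n)) ?w))\<^sup>2) + (\<Sum>k<n. (cmod (cinner (ket k) ?w))\<^sup>2)"
      unfolding norm_ell2_sq[of ?w] by (rule suminf_split_initial_segment[OF summable_ell2])
    then show ?thesis by (simp add: c)
  qed
  moreover have "(\<lambda>n. \<Sum>k. (cmod (cinner (ket (k + n)) u))\<^sup>2) \<longlonglongrightarrow> 0"
    using suminf_exist_split2[OF summable_ell2] by simp
  ultimately have "(\<lambda>n. (norm (u - (\<Sum>i<n. cinner (ket i) u *\<^sub>C ket i)))\<^sup>2) \<longlonglongrightarrow> 0" by simp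
  then have "(\<lambda>n. norm (u - (\<Sum>i<n. cinner (ket i) u *\<^sub>C ket i))) \<longlonglongrightarrow> 0"
    by (auto dest: tendsto_real_sqrt)
  then show ?thesis
    by (subst tendsto_dist_iff) (simp add: dist_norm norm_minus_commute)
qed

section \<open>Paths of tuples with nearly prescribed Gram matrix\<close>

context psd_form
begin

section \<open>Gram-Schmidt for a possibly degenerate form\<close>

definition orthonormal :: "nat \<Rightarrow> (nat \<Rightarrow> ell2) \<Rightarrow> bool" where
  "orthonormal k f \<longleftrightarrow> (\<forall>i<k. \<forall>j<k. B (f i) (f j) = (if i = j then 1 else 0))"

text \<open>\<open>r\<close> is the residual of \<open>v\<close> against the family. A residual of
  length 0 need not vanish, but it pairs to 0 with everything, so the expansion of \<open>v\<close>
  holds inside \<open>B\<close>. Any other residual can be normalised and appended, and then the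
  expansion is an equality of vectors.\<close>

lemma gram_schmidt_step:
  fixes v w :: ell2
  assumes "orthonormal k f"
  defines "r \<equiv> v - (\<Sum>l<k. B (f l) v *\<^sub>C f l)"
  shows "Q r = 0 \<Longrightarrow> B w v = (\<Sum>l<k. B (f l) v * B w (f l))"
    and "Q r \<noteq> 0 \<Longrightarrow> \<exists>g. orthonormal (Suc k) (f(k := g)) \<and> v = (\<Sum>l<k. B (f l) v *\<^sub>C f l) + of_real (sqrt (Q r)) *\<^sub>C g"
proof -
  show "B w v = (\<Sum>l<k. B (f l) v * B w (f l))" if "Q r = 0"
  proof -
    have "B w r = 0" using that by (rule Q_zero_right)
    then show ?thesis by (simp add: r_def diff_right sum_right scale_right)
  qed
  show "\<exists>g. orthonormal (Suc k) (f(k := g)) \<and> v = (\<Sum>l<k. B (f l) v *\<^sub>C f l) + of_real (sqrt (Q r)) *\<^sub>C g"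
    if "Q r \<noteq> 0"
  proof (intro exI conjI)
    have pos: "Q r > 0" using that Q_nonneg[of r] by linarith
    define g where "g = of_real (1 / sqrt (Q r)) *\<^sub>C r"
    have fr: "B (f i) r = 0" if "i < k" for i
    proof -
      have "B (f i) (\<Sum>l<k. B (f l) v *\<^sub>C f l) = (\<Sum>l<k. if i = l then B (f l) v else 0)"
        unfolding sum_right scale_right
        using assms(1) that by (intro sum.cong) (auto simp: orthonormal_def)
      then show ?thesis using that by (simp add: r_def diff_right)
    qed
    have fg: "B (f i) g = 0" "B g (f i) = 0" if "i < k" for i
      using fr[OF that] hermitian[of "f i" g] by (auto simp: g_def scale_right)
    have "Q g = (1 / sqrt (Q r))\<^sup>2 * Q r"
      unfolding g_def Q_scale norm_of_real by simp
    then have "Q g = 1" using pos by (simp add: power_divide)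
    then have "B g g = 1" by (simp add: B_diag)
    then show "orthonormal (Suc k) (f(k := g))"
      using assms(1) fg by (auto simp: orthonormal_def less_Suc_eq)
    have "of_real (sqrt (Q r)) *\<^sub>C g = r"
      using pos by (simp add: g_def flip: of_real_mult)
    then show "v = (\<Sum>l<k. B (f l) v *\<^sub>C f l) + of_real (sqrt (Q r)) *\<^sub>C g"
      by (simp add: r_def)
  qed
qed

text \<open>The expansion of \<open>x i\<close> is stated under \<open>B w\<close>, since the form
  sees vectors only modulo its null space. The vectors are processed one at a time, and the family
  grows only at residuals of positive length.\<close>

lemma gram_schmidt:
  fixes m :: nat
  shows "\<exists>k f c. orthonormal k f \<and> (\<forall>i<m. \<forall>w. B w (x i) = (\<Sum>l<k. c i l * B w (f l)))"
proof (induction m)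
    case 0
    show ?case by (auto intro!: exI[of _ 0] simp: orthonormal_def)
  next
    case (Suc m)
    from Suc.IH obtain k f c where on: "orthonormal k f"
      and c: "\<forall>i<m. \<forall>w. B w (x i) = (\<Sum>l<k. c i l * B w (f l))"
      by (elim exE conjE)
    define v where "v = x m"
    define r where "r = v - (\<Sum>l<k. B (f l) v *\<^sub>C f l)"
    show ?case
    proof (cases "Q r = 0")
      case True
      let ?c = "c(m := \<lambda>l. B (f l) v)"
      have "B w (x i) = (\<Sum>l<k. ?c i l * B w (f l))" if "i < Suc m" for i w
      proof (cases "i = m")
        case True
        then show ?thesis
          using gram_schmidt_step(1)[OF on, of v w] \<open>Q r = 0\<close> unfolding v_def r_def by simp
      qed (use c that in simp)
      then show ?thesis using on by blast
    next
      case False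
      then obtain g where g: "orthonormal (Suc k) (f(k := g))"
        "v = (\<Sum>l<k. B (f l) v *\<^sub>C f l) + of_real (sqrt (Q r)) *\<^sub>C g"
        using gram_schmidt_step(2)[OF on, of v] by (auto simp: r_def)
      have "B w v = (\<Sum>l<k. B (f l) v * B w (f l)) + of_real (sqrt (Q r)) * B w g" for w
        by (subst g(2)) (simp only: add_right sum_right scale_right)
      note v = this
      let ?c = "(\<lambda>i. (c i)(k := 0))(m := (\<lambda>l. B (f l) v)(k := of_real (sqrt (Q r))))"
      have "B w (x i) = (\<Sum>l<Suc k. ?c i l * B w ((f(k := g)) l))" if "i < Suc m" for i w
      proof (cases "i = m")
        case True
        then show ?thesis using v[of w] by (simp flip: v_def)
      qed (use c that in simp)
      then show ?thesis using g(1) by blast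
    qed
  qed

text \<open>The sum is the trace of the product of the Gram matrices of \<open>s\<close> and
  \<open>d\<close>. Expanding \<open>s\<close> in an orthonormal family factors its Gram matrix, and
  the trace becomes a sum of diagonal values \<open>B w w\<close>.\<close>

lemma gram_matrices_trace_nonneg:
  fixes m :: nat
  shows "0 \<le> Re (\<Sum>i<m. \<Sum>j<m. B (s j) (s i) * B (d i) (d j))"
proof -
  from gram_schmidt[of m s] obtain k f c where on: "orthonormal k f"
    and cs: "\<forall>i<m. \<forall>w. B w (s i) = (\<Sum>l<k. c i l * B w (f l))"
    by (elim exE conjE)
  have c: "B w (s i) = (\<Sum>l<k. c i l * B w (f l))" if "i < m" for i w
    using cs that by simp
  have fs: "B (s j) (f l) = cnj (c j l)" if "j < m" "l < k" for j l
  proof -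
    have "B (f l) (s j) = (\<Sum>l'<k. if l = l' then c j l' else 0)"
      unfolding c[OF that(1)] using on that by (intro sum.cong) (auto simp: orthonormal_def)
    then have "B (f l) (s j) = c j l" using that by simp
    then show ?thesis using hermitian[of "s j" "f l"] by simp
  qed
  have "(\<Sum>i<m. \<Sum>j<m. B (s j) (s i) * B (d i) (d j))
      = (\<Sum>i<m. \<Sum>j<m. (\<Sum>l<k. c i l * cnj (c j l)) * B (d i) (d j))"
    using c fs by (intro sum.cong arg_cong2[where f = "(*)"]) auto
  also have "\<dots> = (\<Sum>i<m. \<Sum>j<m. \<Sum>l<k. c i l * cnj (c j l) * B (d i) (d j))"
    by (simp add: sum_distrib_right)
  also have "\<dots> = (\<Sum>i<m. \<Sum>l<k. \<Sum>j<m. c i l * cnj (c j l) * B (d i) (d j))"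
    by (intro sum.cong refl sum.swap)
  also have "\<dots> = (\<Sum>l<k. \<Sum>i<m. \<Sum>j<m. c i l * cnj (c j l) * B (d i) (d j))"
    by (rule sum.swap)
  also have "\<dots> = (\<Sum>l<k. B (\<Sum>i<m. cnj (c i l) *\<^sub>C d i) (\<Sum>j<m. cnj (c j l) *\<^sub>C d j))"
    unfolding sum_left unfolding sum_right scale_left scale_right sum_distrib_left
    by (intro sum.cong refl) simp
  finally show ?thesis by (simp add: Re_diag sum_nonneg)
qed

text \<open>The squared Hilbert-Schmidt distance between the Gram matrix of \<open>x\<close> and
  \<open>A\<close>.\<close>

definition gram_dist :: "nat \<Rightarrow> (nat \<Rightarrow> ell2) \<Rightarrow> (nat \<Rightarrow> nat \<Rightarrow> complex) \<Rightarrow> real" where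
  "gram_dist m x A = (\<Sum>i<m. \<Sum>j<m. (cmod (B (x i) (x j) - A i j))\<^sup>2)"

definition gram_fibre :: "nat \<Rightarrow> (nat \<Rightarrow> ell2) \<Rightarrow> (nat \<Rightarrow> ell2) set" where
  "gram_fibre m x = {z. \<forall>i<m. \<forall>j<m. B (z i) (z j) = B (x i) (x j)}"

text \<open>If \<open>Z u v = \<Sum>\<^sub>i B u (x i) * B (y i) v\<close> is nearly positive, then \<open>x\<close> is nearly the best
  approximation of \<open>y\<close> among the tuples with the Gram matrix of \<open>x\<close>, and the Gram matrix of
  \<open>y - x\<close> is controlled by the difference of the Gram matrices.  This is the trace computation
  \<open>tr (d\<^sup>*d)\<^sup>2 \<le> tr (s\<^sup>*s d\<^sup>*d) \<le> 2 tr \<Delta>\<^sup>2\<close> for \<open>d = y - x\<close>, \<open>s = y + x\<close>, with an error term.\<close>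

lemma gram_diff_le:
  fixes x y :: "nat \<Rightarrow> ell2" and m :: nat
  defines "Z \<equiv> \<lambda>u v. \<Sum>i<m. B u (x i) * B (y i) v"
    and "N \<equiv> \<Sum>i<m. Q (x i) + Q (y i)"
  assumes near_pos: "\<And>v. cmod (Z v v) - Re (Z v v) \<le> \<eta> * Q v" and "\<eta> \<ge> 0"
  shows "(\<Sum>i<m. \<Sum>j<m. (cmod (B (y i - x i) (y j - x j)))\<^sup>2)
    \<le> 2 * gram_dist m y (\<lambda>i j. B (x i) (x j)) + 4 * sqrt (\<eta> * N) * N + 8 * \<eta> * N"
proof -
  define d where "d i = y i - x i" for i
  define s where "s i = y i + x i" for i
  have N0: "N \<ge> 0" unfolding N_def by (intro sum_nonneg add_nonneg_nonneg) auto
  have Zbound: "cmod (Z v v) \<le> N / 2 * Q v" for v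
  proof -
    have "cmod (Z v v) \<le> (\<Sum>i<m. cmod (B v (x i) * B (y i) v))"
      unfolding Z_def by (rule norm_sum)
    also have "\<dots> \<le> (\<Sum>i<m. (Q (x i) + Q (y i)) / 2 * Q v)"
    proof (rule sum_mono)
      fix i
      have "cmod (B v (x i)) * cmod (B (y i) v) \<le> ((cmod (B v (x i)))\<^sup>2 + (cmod (B (y i) v))\<^sup>2) / 2"
        using sum_squares_bound[of "cmod (B v (x i))" "cmod (B (y i) v)"] by simp
      also have "\<dots> \<le> (Q v * Q (x i) + Q (y i) * Q v) / 2"
        using cauchy_schwarz[of v "x i"] cauchy_schwarz[of "y i" v] by simp
      finally show "cmod (B v (x i) * B (y i) v) \<le> (Q (x i) + Q (y i)) / 2 * Q v"
        by (simp add: norm_mult algebra_simps add_divide_distrib)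
    qed
    also have "\<dots> = N / 2 * Q v"
      by (simp add: N_def sum_distrib_right sum_divide_distrib)
    finally show ?thesis .
  qed
  \<comment> \<open>\<open>|Im z|^2 = (|z| - Re z) (|z| + Re z)\<close>: the first factor is at most
    \<open>\<eta> * Q v\<close> by assumption, the second at most \<open>N * Q v\<close> by
    \<open>Zbound\<close>. Thus \<open>Z\<close> is nearly real on the diagonal.\<close>
  define \<kappa> where "\<kappa> = sqrt (\<eta> * N)"
  have k0: "\<kappa> \<ge> 0" using N0 assms(4) by (simp add: \<kappa>_def)
  have ImZ: "\<bar>Im (Z v v)\<bar> \<le> \<kappa> * Q v" for v
  proof (rule power2_le_imp_le)
    have "\<bar>Im (Z v v)\<bar>\<^sup>2 = (cmod (Z v v) - Re (Z v v)) * (cmod (Z v v) + Re (Z v v))"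
      by (simp add: cmod_power2 algebra_simps flip: power2_eq_square)
    also have "\<dots> \<le> (\<eta> * Q v) * (N * Q v)"
    proof (rule mult_mono)
      show "cmod (Z v v) + Re (Z v v) \<le> N * Q v"
        using Zbound[of v] complex_Re_le_cmod[of "Z v v"] by linarith
      show "0 \<le> cmod (Z v v) + Re (Z v v)"
        using abs_Re_le_cmod[of "Z v v"] by linarith
    qed (use near_pos assms(4) in auto)
    also have "\<dots> = (\<kappa> * Q v)\<^sup>2"
      using N0 assms(4) by (simp add: \<kappa>_def power_mult_distrib) (simp add: power2_eq_square)
    finally show "\<bar>Im (Z v v)\<bar>\<^sup>2 \<le> (\<kappa> * Q v)\<^sup>2" .
  qed (use k0 in auto)
  \<comment> \<open>Polarisation along \<open>u + \<i> *\<^sub>C v\<close> and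
    \<open>u + (-\<i>) *\<^sub>C v\<close> carries the bound from the diagonal to the failure of
    symmetry of \<open>Re (Z u v)\<close>.\<close>
  have ReZ_swap: "\<bar>Re (Z u v) - Re (Z v u)\<bar> \<le> \<kappa> * (Q u + Q v)" for u v
  proof -
    have add: "Z (a + b) (a + b) = Z a a + Z a b + Z b a + Z b b" for a b
      by (simp add: Z_def add_left add_right algebra_simps sum.distrib)
    have "Z a (c *\<^sub>C b) = c * Z a b" "Z (c *\<^sub>C a) b = cnj c * Z a b" for a b c
      by (simp_all add: Z_def scale_left scale_right sum_distrib_left mult_ac)
    note Zs = add this
    let ?p = "u + \<i> *\<^sub>C v" and ?q = "u + (-\<i>) *\<^sub>C v"
    have "Im (Z ?p ?p) - Im (Z ?q ?q) = 2 * (Re (Z u v) - Re (Z v u))"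
      unfolding Zs by (simp add: Zs)
    moreover have "\<bar>Im (Z ?p ?p) - Im (Z ?q ?q)\<bar> \<le> \<kappa> * (Q ?p + Q ?q)"
      using ImZ[of ?p] ImZ[of ?q] by (simp add: distrib_left)
    moreover have "Q ?p + Q ?q = 2 * Q u + 2 * Q v"
      using parallelogram[of u "\<i> *\<^sub>C v"] by simp
    ultimately have "\<bar>2 * (Re (Z u v) - Re (Z v u))\<bar> \<le> \<kappa> * (2 * Q u + 2 * Q v)"
      by metis
    then show ?thesis by (simp add: abs_mult distrib_left)
  qed
  have Qds: "(\<Sum>j<m. Q (s j) + Q (d j)) = 2 * N"
    unfolding N_def d_def s_def parallelogram sum_distrib_left by (simp add: algebra_simps)
  have Qd: "(\<Sum>j<m. Q (d j)) \<le> 2 * N"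
    unfolding Qds[symmetric] by (intro sum_mono) auto
  \<comment> \<open>The mixed Gram matrix; its Hermitian part is the difference of the Gram matrices
    of \<open>y\<close> and \<open>x\<close>.\<close>
  define p where "p i j = B (s i) (d j)" for i j
  \<comment> \<open>The two traces agree when \<open>Z\<close> is Hermitian. In general their
    difference is twice the Hermitian defect of \<open>Z\<close>, summed over the pairs
    \<open>d j\<close>, \<open>s j\<close>, and \<open>ReZ_swap\<close> bounds its real
    part.\<close>
  have "(\<Sum>i<m. \<Sum>j<m. p i j * p j i) - (\<Sum>i<m. \<Sum>j<m. B (s j) (s i) * B (d i) (d j))
      = (\<Sum>j<m. \<Sum>i<m. B (s j) (d i) * B (s i) (d j) - B (s j) (s i) * B (d i) (d j))"
    by (subst (2) sum.swap, subst sum.swap) (simp add: p_def sum_subtractf mult.commute)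
  also have "\<dots> = (\<Sum>j<m. 2 * (cnj (Z (d j) (s j)) - Z (s j) (d j)))"
  proof (rule sum.cong[OF refl])
    fix j
    have "(\<Sum>i<m. B u (d i) * B (s i) v - B u (s i) * B (d i) v)
      = 2 * ((\<Sum>i<m. B u (y i) * B (x i) v) - Z u v)" for u v
      unfolding Z_def d_def s_def sum_subtractf[symmetric] sum_distrib_left
      by (intro sum.cong refl) (simp add: add_left add_right diff_left diff_right algebra_simps)
    moreover have "(\<Sum>i<m. B u (y i) * B (x i) v) = cnj (Z v u)" for u v
      unfolding Z_def cnj_sum
      by (intro sum.cong refl) (simp add: hermitian[of u] hermitian[of v])
    ultimately show "(\<Sum>i<m. B (s j) (d i) * B (s i) (d j) - B (s j) (s i) * B (d i) (d j))
       = 2 * (cnj (Z (d j) (s j)) - Z (s j) (d j))" by simp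
  qed
  finally have "Re ((\<Sum>i<m. \<Sum>j<m. p i j * p j i) - (\<Sum>i<m. \<Sum>j<m. B (s j) (s i) * B (d i) (d j)))
      = Re (\<Sum>j<m. 2 * (cnj (Z (d j) (s j)) - Z (s j) (d j)))" by (rule arg_cong)
  then have "Re (\<Sum>i<m. \<Sum>j<m. p i j * p j i) - Re (\<Sum>i<m. \<Sum>j<m. B (s j) (s i) * B (d i) (d j))
      = (\<Sum>j<m. 2 * (Re (Z (d j) (s j)) - Re (Z (s j) (d j))))"
    unfolding minus_complex.sel Re_sum by simp
  also have "\<dots> \<ge> (\<Sum>j<m. - 2 * \<kappa> * (Q (s j) + Q (d j)))"
  proof (rule sum_mono)
    fix j
    show "- 2 * \<kappa> * (Q (s j) + Q (d j)) \<le> 2 * (Re (Z (d j) (s j)) - Re (Z (s j) (d j)))"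
      using ReZ_swap[of "s j" "d j"] by (auto simp: abs_le_iff algebra_simps)
  qed
  also have "(\<Sum>j<m. - 2 * \<kappa> * (Q (s j) + Q (d j))) = - 4 * \<kappa> * N"
    unfolding sum_distrib_left[symmetric] Qds by simp
  finally have trp: "Re (\<Sum>i<m. \<Sum>j<m. p i j * p j i) \<ge> - 4 * \<kappa> * N"
    using gram_matrices_trace_nonneg[where m = m and s = s and d = d] by linarith

  \<comment> \<open>The square of the Hermitian part of \<open>p\<close> is expanded; the cross
    terms add up to twice the real part of the trace of the square of \<open>p\<close>, which
    \<open>trp\<close> bounds from below.\<close>
  have "4 * gram_dist m y (\<lambda>i j. B (x i) (x j))
    = (\<Sum>i<m. \<Sum>j<m. (cmod (p i j))\<^sup>2 + (cmod (p j i))\<^sup>2 + 2 * Re (p i j * p j i))"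
    unfolding gram_dist_def sum_distrib_left
  proof (intro sum.cong refl)
    fix i j
    have "p i j + cnj (p j i) = 2 * (B (y i) (y j) - B (x i) (x j))"
      using hermitian[of "s j" "d i"]
      by (simp add: p_def s_def d_def add_left add_right diff_left diff_right)
    then have "4 * (cmod (B (y i) (y j) - B (x i) (x j)))\<^sup>2 = (cmod (p i j + cnj (p j i)))\<^sup>2"
      by (simp only: norm_mult power_mult_distrib) simp
    also have "\<dots> = (cmod (p i j))\<^sup>2 + (cmod (p j i))\<^sup>2 + 2 * Re (p i j * p j i)"
      unfolding cmod_power2 by (simp add: power2_eq_square algebra_simps)
    finally show "4 * (cmod (B (y i) (y j) - B (x i) (x j)))\<^sup>2
      = (cmod (p i j))\<^sup>2 + (cmod (p j i))\<^sup>2 + 2 * Re (p i j * p j i)" .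
  qed
  also have "\<dots> = 2 * (\<Sum>i<m. \<Sum>j<m. (cmod (p i j))\<^sup>2) + 2 * Re (\<Sum>i<m. \<Sum>j<m. p i j * p j i)"
    unfolding sum.distrib by (subst (2) sum.swap) (simp add: sum_distrib_left)
  finally have sp: "(\<Sum>i<m. \<Sum>j<m. (cmod (p i j))\<^sup>2)
      \<le> 2 * gram_dist m y (\<lambda>i j. B (x i) (x j)) + 4 * \<kappa> * N"
    using trp by linarith

  \<comment> \<open>Polarisation of \<open>|a + b|^2 - |a - b|^2\<close>: near positivity of
    \<open>Z\<close> says that \<open>s\<close> nearly dominates \<open>d\<close> as seen from every
    \<open>v\<close>. This is used at \<open>v = d j\<close>.\<close>
  have dp: "(\<Sum>i<m. (cmod (B (d i) v))\<^sup>2) \<le> (\<Sum>i<m. (cmod (B (s i) v))\<^sup>2) + 4 * \<eta> * Q v" for v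
  proof -
    have "(\<Sum>i<m. (cmod (B (s i) v))\<^sup>2) - (\<Sum>i<m. (cmod (B (d i) v))\<^sup>2) = 4 * Re (Z v v)"
      unfolding Z_def Re_sum sum_distrib_left sum_subtractf[symmetric]
    proof (intro sum.cong refl)
      fix i
      have sq: "(cmod (a + b))\<^sup>2 - (cmod (a - b))\<^sup>2 = 4 * Re (cnj b * a)" for a b
        unfolding cmod_power2 by (simp add: power2_eq_square algebra_simps)
      show "(cmod (B (s i) v))\<^sup>2 - (cmod (B (d i) v))\<^sup>2 = 4 * Re (B v (x i) * B (y i) v)"
        unfolding s_def d_def add_left diff_left sq hermitian[of v "x i"] ..
    qed
    moreover have "- (\<eta> * Q v) \<le> Re (Z v v)"
      using near_pos[of v] by (smt (verit) norm_ge_zero)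
    ultimately show ?thesis by linarith
  qed
  have "(\<Sum>j<m. \<Sum>i<m. (cmod (B (d i) (d j)))\<^sup>2)
      \<le> (\<Sum>j<m. (\<Sum>i<m. (cmod (p i j))\<^sup>2) + 4 * \<eta> * Q (d j))"
    unfolding p_def by (intro sum_mono dp)
  also have "\<dots> = (\<Sum>i<m. \<Sum>j<m. (cmod (p i j))\<^sup>2) + 4 * \<eta> * (\<Sum>j<m. Q (d j))"
    unfolding sum.distrib sum_distrib_left by (subst sum.swap) (rule refl)
  also have "\<dots> \<le> 2 * gram_dist m y (\<lambda>i j. B (x i) (x j)) + 4 * \<kappa> * N + 4 * \<eta> * (2 * N)"
    by (intro add_mono sp mult_left_mono Qd) (use assms(4) in auto)
  finally show ?thesis
    by (subst sum.swap) (simp add: \<kappa>_def d_def)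
qed

text \<open>The complex reflection that multiplies the component along \<open>v\<close> by a number
  of modulus 1 preserves \<open>B\<close>, hence all Gram matrices; turning this number along the
  circle from 1 to \<open>\<zeta>\<close> gives the path.\<close>

lemma gram_fibre_reflection:
  assumes "Q v = 1" "cmod \<zeta> = 1"
  shows "path_component (gram_fibre m x) x (\<lambda>i. x i + ((\<zeta> - 1) * B v (x i)) *\<^sub>C v)"
proof -
  obtain \<theta> where \<theta>: "\<zeta> = cis \<theta>" using complex_unit_circle[of \<zeta>] assms(2)
    by (metis cis_Arg norm_zero zero_neq_one sgn_eq div_by_1 of_real_1)
  define g where "g t = (\<lambda>i. x i + ((cis (t * \<theta>) - 1) * B v (x i)) *\<^sub>C v)" for t
  have "path g"
    unfolding path_def g_def cis_conv_exp
    by (intro continuous_on_coordinatewise_then_product continuous_intros continuous_on_scaleC)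
  moreover have "g t \<in> gram_fibre m x" for t
  proof -
    define c where "c = cis (t * \<theta>)"
    have "B (g t i) (g t j) = B (x i) (x j)" for i j
    proof -
      have expand: "B (a + \<alpha> *\<^sub>C v) (b + \<beta> *\<^sub>C v) = B a b + \<beta> * B a v + cnj \<alpha> * B v b + cnj \<alpha> * \<beta>"
        for a b \<alpha> \<beta>
        using assms(1) by (simp add: add_left add_right scale_left scale_right B_diag distrib_left mult.commute)
      have "B (g t i) (g t j)
        = B (x i) (x j) + (c * cnj c - 1) * (cnj (B v (x i)) * B v (x j))"
        unfolding g_def c_def[symmetric] expand hermitian[of "x i" v] by (simp add: algebra_simps)
      moreover have "c * cnj c = 1" by (simp add: c_def cis_cnj cis_mult)
      ultimately show ?thesis by simp
    qed
    then show ?thesis by (simp add: gram_fibre_def)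
  qed
  moreover have "g 0 = x" "g 1 = (\<lambda>i. x i + ((\<zeta> - 1) * B v (x i)) *\<^sub>C v)"
    by (simp_all add: g_def \<theta>)
  ultimately show ?thesis
    unfolding path_component_def
    by (intro exI[of _ g]) (auto simp: path_image_def pathstart_def pathfinish_def)
qed

text \<open>The path consists of a path inside the Gram fibre of \<open>x\<close>, joining
  \<open>x\<close> to some \<open>x'\<close> that is nearly the closest reachable tuple to
  \<open>y\<close>, and of the segment between \<open>x'\<close> and \<open>y\<close>. The factor 4
  leaves room for the error along the segment.\<close>

lemma gram_dist_path:
  assumes "gram_dist m y (\<lambda>i j. B (x i) (x j)) < \<eta>"
  shows "path_component {z. gram_dist m z (\<lambda>i j. B (x i) (x j)) < 4 * \<eta>} y x"
proof -
  define S where "S = {z. gram_dist m z (\<lambda>i j. B (x i) (x j)) < 4 * \<eta>}"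
  have \<eta>: "\<eta> > 0"
    using assms unfolding gram_dist_def by (smt (verit) sum_nonneg zero_le_power2)
  define N where "N = (\<Sum>i<m. Q (x i) + Q (y i))"
  \<comment> \<open>\<open>e\<close> is chosen so small that the error terms of
    \<open>gram_diff_le\<close> stay below \<open>2 * \<eta>\<close>.\<close>
  have "((\<lambda>e. 4 * sqrt (e * N) * N + 8 * e * N) \<longlongrightarrow> 4 * sqrt (0 * N) * N + 8 * 0 * N) (at_right 0)"
    by (intro tendsto_intros)
  then have "eventually (\<lambda>e. 4 * sqrt (e * N) * N + 8 * e * N < 2 * \<eta>) (at_right 0)"
    using \<eta> by (intro order_tendstoD(2)) auto
  then have "eventually (\<lambda>e. 4 * sqrt (e * N) * N + 8 * e * N < 2 * \<eta> \<and> e > 0) (at_right 0)"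
    by (intro eventually_conj eventually_at_right_less)
  then obtain e where e: "4 * sqrt (e * N) * N + 8 * e * N < 2 * \<eta>" "e > 0"
    by (metis (mono_tags, lifting) eventually_happens trivial_limit_at_right_real)

  define O' where "O' = path_component_set (gram_fibre m x) x"
  \<comment> \<open>On the fibre all \<open>Q (z i)\<close> are fixed, so a large \<open>L z\<close>
    means a small sum of the \<open>Q (y i - z i)\<close>. The supremum over \<open>O'\<close> need
    not be attained and is approached up to \<open>e\<close>.\<close>
  define L where "L z = Re (\<Sum>i<m. B (y i) (z i))" for z
  have xO: "x \<in> O'" unfolding O'_def by (simp add: path_component_refl gram_fibre_def)
  have fib: "B (z i) (z j) = B (x i) (x j)" if "z \<in> O'" "i < m" "j < m" for z i j
    using that path_component_mem(2)[of "gram_fibre m x" x z] by (simp add: O'_def gram_fibre_def)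
  have fibQ: "Q (z i) = Q (x i)" if "z \<in> O'" "i < m" for z i
    using fib[OF that that(2)] by (simp add: Q_def)
  have bdd: "bdd_above (L ` O')"
  proof (rule bdd_aboveI2)
    fix z assume z: "z \<in> O'"
    have "L z \<le> cmod (\<Sum>i<m. B (y i) (z i))" unfolding L_def by (rule complex_Re_le_cmod)
    also have "\<dots> \<le> (\<Sum>i<m. cmod (B (y i) (z i)))" by (rule norm_sum)
    also have "\<dots> \<le> (\<Sum>i<m. (Q (y i) + Q (x i)) / 2)"
      using cmod_B_le fibQ[OF z] by (intro sum_mono) (metis lessThan_iff)
    finally show "L z \<le> (\<Sum>i<m. (Q (y i) + Q (x i)) / 2)" .
  qed
  have "\<exists>x'\<in>O'. Sup (L ` O') - e < L x'"
    using less_cSup_iff[of "L ` O'" "Sup (L ` O') - e"] bdd xO e(2) by auto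
  then obtain x' where x': "x' \<in> O'" and sup: "Sup (L ` O') - e < L x'" by blast
  have near_max: "L z \<le> L x' + e" if "z \<in> O'" for z
    using cSup_upper[OF imageI[OF that] bdd] sup by linarith

  define Z where "Z = (\<lambda>u v. \<Sum>i<m. B u (x' i) * B (y i) v)"
  \<comment> \<open>Reflecting \<open>x'\<close> along \<open>v\<close> with the phase
    \<open>\<zeta>\<close> that rotates \<open>Z v v\<close> to its modulus raises \<open>L\<close>
    by \<open>cmod (Z v v) - Re (Z v v)\<close>; near maximality bounds this gain by
    \<open>e\<close>.\<close>
  have near_pos1: "cmod (Z v v) - Re (Z v v) \<le> e" if "Q v = 1" for v
  proof (cases "Z v v = 0")
    case False
    define \<zeta> where "\<zeta> = cnj (Z v v) / cmod (Z v v)"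
    define z where "z = (\<lambda>i. x' i + ((\<zeta> - 1) * B v (x' i)) *\<^sub>C v)"
    have "cmod \<zeta> = 1" using False by (simp add: \<zeta>_def norm_divide)
    from gram_fibre_reflection[OF that this, of m x']
    have "path_component (gram_fibre m x') x' z" by (simp add: z_def)
    moreover have "gram_fibre m x' = gram_fibre m x"
      using fib[OF x'] by (auto simp: gram_fibre_def)
    ultimately have "z \<in> O'" using x' unfolding O'_def
      by (auto intro: path_component_trans)
    then have "L z \<le> L x' + e" by (rule near_max)
    moreover have "(\<Sum>i<m. B (y i) (z i)) = (\<Sum>i<m. B (y i) (x' i)) + (\<zeta> - 1) * Z v v"
      by (simp add: z_def Z_def add_right scale_right sum.distrib sum_distrib_left mult_ac)
    then have "L z = L x' + Re ((\<zeta> - 1) * Z v v)"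
      by (simp only: L_def plus_complex.sel)
    moreover have "\<zeta> * Z v v = cmod (Z v v)"
      using False complex_norm_square[of "Z v v"]
      by (simp add: \<zeta>_def field_simps power2_eq_square)
    ultimately show ?thesis by (simp add: left_diff_distrib)
  qed (use e(2) in simp)
  have near_pos: "cmod (Z v v) - Re (Z v v) \<le> e * Q v" for v
  proof (cases "Q v = 0")
    case True
    then show ?thesis by (simp add: Z_def Q_zero_left)
  next
    case False
    then have pos: "Q v > 0" using Q_nonneg[of v] by linarith
    define w where "w = of_real (1 / sqrt (Q v)) *\<^sub>C v"
    have "Q w = (1 / sqrt (Q v))\<^sup>2 * Q v"
      unfolding w_def Q_scale norm_of_real by simp
    then have "Q w = 1" using pos by (simp add: power_divide)
    have "v = of_real (sqrt (Q v)) *\<^sub>C w"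
      using pos by (simp add: w_def flip: of_real_mult)
    then have "Z v v = (\<Sum>i<m. B (of_real (sqrt (Q v)) *\<^sub>C w) (x' i) * B (y i) (of_real (sqrt (Q v)) *\<^sub>C w))"
      unfolding Z_def by simp
    also have "\<dots> = of_real (sqrt (Q v) * sqrt (Q v)) * Z w w"
      unfolding Z_def scale_left scale_right sum_distrib_left of_real_mult complex_cnj_complex_of_real
      by (intro sum.cong refl) (simp only: mult_ac)
    finally have "Z v v = of_real (Q v) * Z w w" by simp
    then have "cmod (Z v v) - Re (Z v v) = Q v * (cmod (Z w w) - Re (Z w w))"
      by (simp add: norm_mult right_diff_distrib)
    also have "\<dots> \<le> Q v * e"
      using near_pos1[OF \<open>Q w = 1\<close>] by (intro mult_left_mono) auto
    finally show ?thesis by (simp add: mult.commute)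
  qed

  define d where "d i = y i - x' i" for i
  define D where "D i j = B (y i) (y j) - B (x i) (x j)" for i j
  have N': "(\<Sum>i<m. Q (x' i) + Q (y i)) = N" unfolding N_def by (simp add: fibQ[OF x'])
  have gd: "gram_dist m z (\<lambda>i j. B (x' i) (x' j)) = gram_dist m z (\<lambda>i j. B (x i) (x j))" for z
    unfolding gram_dist_def by (simp add: fib[OF x'])
  have "(\<Sum>i<m. \<Sum>j<m. (cmod (B (d i) (d j)))\<^sup>2)
    \<le> 2 * gram_dist m y (\<lambda>i j. B (x i) (x j)) + 4 * sqrt (e * N) * N + 8 * e * N"
    using gram_diff_le[where m = m and x = x' and y = y and \<eta> = e] near_pos e(2) unfolding N' gd d_def Z_def by simp
  then have dd: "(\<Sum>i<m. \<Sum>j<m. (cmod (B (d i) (d j)))\<^sup>2) < 4 * \<eta>"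
    using assms e(1) by linarith
  have DD: "(\<Sum>i<m. \<Sum>j<m. (cmod (D i j))\<^sup>2) < \<eta>"
    using assms unfolding gram_dist_def D_def .

  define g where "g t = (\<lambda>i. x' i + t *\<^sub>R d i)" for t
  have "g t \<in> S" if t: "t \<in> {0..1}" for t
  proof -
    have "gram_dist m (g t) (\<lambda>i j. B (x i) (x j))
      \<le> (\<Sum>i<m. \<Sum>j<m. 2 * (cmod (D i j))\<^sup>2 + (cmod (B (d i) (d j)))\<^sup>2 / 8)"
      unfolding gram_dist_def
    proof (intro sum_mono)
      fix i j assume ij: "i \<in> {..<m}" "j \<in> {..<m}"
      \<comment> \<open>Along the segment the Gram error is
        \<open>t * D i j - q * B (d i) (d j)\<close>, and \<open>q\<close> is at most 1/4. The
        bounds \<open>\<eta>\<close> and \<open>4 * \<eta>\<close> for the two sums of squares then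
        give less than \<open>5/2 * \<eta>\<close>.\<close>
      define q where "q = t * (1 - t)"
      have "0 \<le> q" using t by (simp add: q_def)
      moreover have "q \<le> 1 / 4"
        using zero_le_power2[of "t - 1 / 2"] unfolding q_def power2_eq_square by (simp add: algebra_simps)
      ultimately have q: "q\<^sup>2 \<le> 1 / 16"
        using power_mono[of q "1/4" 2] by (simp add: power2_eq_square)
      have t2: "t\<^sup>2 \<le> 1" using t by (simp add: power_le_one)
      have "B (g t i) (g t j) - B (x i) (x j) = of_real t * D i j - of_real q * B (d i) (d j)"
        using fib[OF x', of i j] ij
        by (simp add: g_def d_def D_def q_def add_left add_right diff_left diff_right
            scaleR_left scaleR_right algebra_simps)
      then have "cmod (B (g t i) (g t j) - B (x i) (x j)) \<le> cmod (of_real t * D i j) + cmod (of_real q * B (d i) (d j))"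
        by (simp only: norm_triangle_ineq4)
      then have "cmod (B (g t i) (g t j) - B (x i) (x j)) \<le> t * cmod (D i j) + q * cmod (B (d i) (d j))"
        using t \<open>0 \<le> q\<close> by (simp add: norm_mult)
      then have "(cmod (B (g t i) (g t j) - B (x i) (x j)))\<^sup>2 \<le> (t * cmod (D i j) + q * cmod (B (d i) (d j)))\<^sup>2"
        by (intro power_mono) auto
      also have "\<dots> \<le> 2 * (t * cmod (D i j))\<^sup>2 + 2 * (q * cmod (B (d i) (d j)))\<^sup>2"
        using sum_squares_bound[of "t * cmod (D i j)" "q * cmod (B (d i) (d j))"]
        unfolding power2_sum by linarith
      also have "\<dots> = 2 * (t\<^sup>2 * (cmod (D i j))\<^sup>2) + 2 * (q\<^sup>2 * (cmod (B (d i) (d j)))\<^sup>2)"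
        by (simp only: power_mult_distrib)
      also have "\<dots> \<le> 2 * (1 * (cmod (D i j))\<^sup>2) + 2 * (1 / 16 * (cmod (B (d i) (d j)))\<^sup>2)"
        by (intro add_mono mult_left_mono mult_right_mono q t2) auto
      finally show "(cmod (B (g t i) (g t j) - B (x i) (x j)))\<^sup>2
          \<le> 2 * (cmod (D i j))\<^sup>2 + (cmod (B (d i) (d j)))\<^sup>2 / 8" by simp
    qed
    also have "\<dots> = 2 * (\<Sum>i<m. \<Sum>j<m. (cmod (D i j))\<^sup>2) + (\<Sum>i<m. \<Sum>j<m. (cmod (B (d i) (d j)))\<^sup>2) / 8"
      by (simp add: sum.distrib sum_distrib_left sum_divide_distrib)
    also have "\<dots> < 4 * \<eta>" using dd DD \<eta> by linarith
    finally show ?thesis by (simp add: S_def)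
  qed
  moreover have "path g"
    unfolding path_def g_def
    by (intro continuous_on_coordinatewise_then_product continuous_intros)
  moreover have "g 0 = x'" "g 1 = y" by (simp_all add: g_def d_def)
  ultimately have "path_component S x' y"
    unfolding path_component_def
    by (intro exI[of _ g]) (auto simp: path_image_def pathstart_def pathfinish_def)
  moreover have "path_component S x x'"
  proof (rule path_component_of_subset)
    show "path_component (gram_fibre m x) x x'" using x' by (simp add: O'_def)
    show "gram_fibre m x \<subseteq> S" using \<eta> by (auto simp: gram_fibre_def S_def gram_dist_def)
  qed
  ultimately show ?thesis
    unfolding S_def by (meson path_component_sym path_component_trans)
qed

end

section \<open>Operators: rank, adjoints, compactness\<close>

definition op_form :: "operator \<Rightarrow> ell2 \<Rightarrow> ell2 \<Rightarrow> complex" where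
  "op_form T u v = cinner u (blinfun_apply T v)"

text \<open>Elements of the type \<open>operator\<close> are real-linear, so complex linearity is a
  separate predicate.\<close>

definition clinear_op :: "operator \<Rightarrow> bool" where
  "clinear_op T \<longleftrightarrow> (\<forall>c u. blinfun_apply T (c *\<^sub>C u) = c *\<^sub>C blinfun_apply T u)"

lemma compact_operators_clinear: "T \<in> compact_operators \<Longrightarrow> clinear_op T"
  by (simp add: compact_operators_def clinear_op_def)

lemma psd_form_op_form:
  assumes "clinear_op T" "positive_operator T"
  shows "psd_form (op_form T)"
proof
  fix v
  have "cinner v (blinfun_apply T v) \<in> \<real>\<^sub>\<ge>\<^sub>0"
    using assms(2) by (simp add: positive_operator_def)
  then show "Im (op_form T v v) = 0" "0 \<le> Re (op_form T v v)"
    by (auto simp: op_form_def complex_nonneg_Reals_iff)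
qed (use assms(1) in \<open>auto simp: op_form_def clinear_op_def cinner_add_left cinner_add_right
       cinner_scaleC_left cinner_scaleC_right blinfun.add_right\<close>)

text \<open>Passes from families indexed by numbers, as in Gram matrices, to independent sets;
  injectivity keeps track of the cardinality.\<close>

lemma independent_family:
  fixes k :: nat
  assumes "\<And>c. (\<Sum>i<k. c i *\<^sub>C g i) = 0 \<Longrightarrow> \<forall>i<k. c i = 0"
  shows "inj_on g {..<k} \<and> ell2.independent (g ` {..<k})"
proof
  show inj: "inj_on g {..<k}"
  proof (rule inj_onI, rule ccontr)
    fix i j assume ij: "i \<in> {..<k}" "j \<in> {..<k}" "g i = g j" "i \<noteq> j"
    define c where "c l = (if l = i then 1 else if l = j then - 1 else 0 :: complex)" for l
    have "(\<Sum>l<k. c l *\<^sub>C g l) = (\<Sum>l\<in>{i, j}. c l *\<^sub>C g l)"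
      using ij by (intro sum.mono_neutral_right) (auto simp: c_def)
    also have "\<dots> = 0" using ij by (simp add: c_def)
    finally show False using assms[of c] ij by (auto simp: c_def)
  qed
  show "ell2.independent (g ` {..<k})"
  proof (rule ell2.independent_if_scalars_zero)
    fix f x assume "(\<Sum>x\<in>g ` {..<k}. f x *\<^sub>C x) = 0" "x \<in> g ` {..<k}"
    then show "f x = 0" using assms[of "f \<circ> g"] by (auto simp: sum.reindex[OF inj])
  qed simp
qed

lemma operator_rank_le_card:
  assumes "range (blinfun_apply T) \<subseteq> ell2.span S" "finite S"
  shows "operator_rank T \<le> enat (card S)"
  using assms ell2.dim_le_card[OF assms] by (auto simp: operator_rank_def)

lemma operator_rank_geI:
  assumes "ell2.independent S" "finite S" "S \<subseteq> range (blinfun_apply T)"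
  shows "enat (card S) \<le> operator_rank T"
proof (cases "\<exists>B. finite B \<and> range (blinfun_apply T) \<subseteq> ell2.span B")
  case True
  then obtain B where B: "finite B" "range (blinfun_apply T) \<subseteq> ell2.span B" by blast
  obtain C where C: "C \<subseteq> range (blinfun_apply T)" "ell2.independent C"
    "range (blinfun_apply T) \<subseteq> ell2.span C" "card C = ell2.dim (range (blinfun_apply T))"
    by (rule ell2.basis_exists)
  have "finite C" using ell2.independent_span_bound[OF B(1) C(2)] C(1) B(2) by blast
  then have "card S \<le> card C"
    using ell2.independent_span_bound[of C S] assms C(3) by blast
  then show ?thesis using True C(4) by (simp add: operator_rank_def)
next
  case False
  then have "operator_rank T = \<infinity>" unfolding operator_rank_def by (rule if_not_P)
  then show ?thesis by simp
qed

text \<open>The slack in this criterion, compared with orthonormality, is what makes the rank lower semicontinuous.\<close>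

lemma operator_rank_ge_gram:
  assumes "clinear_op T" "positive_operator T"
    and "psd_form.gram_dist (op_form T) k f (\<lambda>i j. if i = j then 1 else 0) < 1"
  shows "enat k \<le> operator_rank T"
proof -
  interpret psd_form "op_form T" using assms(1,2) by (rule psd_form_op_form)
  define g where "g i = blinfun_apply T (f i)" for i
  define e where "e i j = op_form T (f i) (f j) - (if i = j then 1 else 0)" for i j
  have e1: "(\<Sum>i<k. \<Sum>j<k. (cmod (e i j))\<^sup>2) < 1"
    using assms(3) by (simp add: gram_dist_def e_def)
  \<comment> \<open>The Gram matrix is the identity plus \<open>e\<close>, and the Hilbert-Schmidt
    norm of \<open>e\<close> is below 1. A linear relation \<open>c\<close> satisfies
    \<open>c = - e c\<close>, so Cauchy-Schwarz forces it to be 0.\<close>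
  have "\<forall>i<k. c i = 0" if c: "(\<Sum>i<k. c i *\<^sub>C g i) = 0" for c
  proof -
    define C where "C = (\<Sum>i<k. (cmod (c i))\<^sup>2)"
    have C0: "C \<ge> 0" by (simp add: C_def sum_nonneg)
    have le: "(cmod (c i))\<^sup>2 \<le> (\<Sum>j<k. (cmod (e i j))\<^sup>2) * C" if i: "i < k" for i
    proof -
      have "0 = cinner (f i) (\<Sum>j<k. c j *\<^sub>C g j)" by (simp add: c)
      also have "\<dots> = (\<Sum>j<k. c j * (e i j + (if i = j then 1 else 0)))"
        by (simp add: cinner.sum_right cinner_scaleC_right g_def e_def op_form_def)
      also have "\<dots> = (\<Sum>j<k. c j * e i j) + (\<Sum>j<k. if i = j then c j else 0)"
        unfolding sum.distrib[symmetric] by (intro sum.cong) (auto simp: distrib_left)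
      finally have "c i = - (\<Sum>j<k. c j * e i j)" using i by (simp add: eq_neg_iff_add_eq_0 add.commute)
      then have "cmod (c i) \<le> (\<Sum>j<k. cmod (e i j) * cmod (c j))"
        using norm_sum[of "\<lambda>j. c j * e i j" "{..<k}"] by (simp add: norm_mult mult.commute)
      then have "(cmod (c i))\<^sup>2 \<le> (\<Sum>j<k. cmod (e i j) * cmod (c j))\<^sup>2"
        by (intro power_mono) auto
      also have "\<dots> \<le> (\<Sum>j<k. (cmod (e i j))\<^sup>2) * C"
        unfolding C_def by (rule Cauchy_Schwarz_ineq_sum)
      finally show ?thesis .
    qed
    have "C \<le> (\<Sum>i<k. (\<Sum>j<k. (cmod (e i j))\<^sup>2) * C)"
      unfolding C_def by (rule sum_mono) (use le in \<open>simp add: C_def\<close>)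
    also have "\<dots> = (\<Sum>i<k. \<Sum>j<k. (cmod (e i j))\<^sup>2) * C" by (simp add: sum_distrib_right)
    finally have "C \<le> (\<Sum>i<k. \<Sum>j<k. (cmod (e i j))\<^sup>2) * C" .
    then have "C = 0" using mult_strict_right_mono[OF e1, of C] C0 by linarith
    then show ?thesis unfolding C_def by (subst (asm) sum_nonneg_eq_0_iff) auto
  qed
  from independent_family[OF this]
  have inj: "inj_on g {..<k}" and ind: "ell2.independent (g ` {..<k})" by auto
  have "enat (card (g ` {..<k})) \<le> operator_rank T"
    by (rule operator_rank_geI[OF ind]) (auto simp: g_def)
  then show ?thesis by (simp add: card_image[OF inj])
qed

lemma operator_rank_ge_iff:
  assumes "clinear_op T" "positive_operator T"
  shows "enat k \<le> operator_rank T \<longleftrightarrow> (\<exists>f. psd_form.orthonormal (op_form T) k f)"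
proof -
  interpret psd_form "op_form T" using assms by (rule psd_form_op_form)
  show ?thesis
  proof
    assume "\<exists>f. orthonormal k f"
    then obtain f where "orthonormal k f" by blast
    then have "gram_dist k f (\<lambda>i j. if i = j then 1 else 0) = 0"
      by (simp add: gram_dist_def orthonormal_def)
    then show "enat k \<le> operator_rank T"
      using operator_rank_ge_gram[OF assms, of k f] by simp
  next
    assume k: "enat k \<le> operator_rank T"
    have "j \<le> k \<Longrightarrow> \<exists>f. orthonormal j f" for j
    proof (induction j)
      case 0
      show ?case by (simp add: orthonormal_def)
    next
      case (Suc j)
      then obtain f where f: "orthonormal j f" by auto
      \<comment> \<open>If every residual had length 0, the images of the \<open>f l\<close> with
        \<open>l < j\<close> would span the range of \<open>T\<close>, and the rank would be at most
        \<open>j\<close>, which is less than \<open>k\<close>.\<close>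
      have "\<exists>v. Q (v - (\<Sum>l<j. op_form T (f l) v *\<^sub>C f l)) \<noteq> 0"
      proof (rule ccontr)
        assume "\<nexists>v. Q (v - (\<Sum>l<j. op_form T (f l) v *\<^sub>C f l)) \<noteq> 0"
        then have exp: "op_form T w v = (\<Sum>l<j. op_form T (f l) v * op_form T w (f l))" for v w
          using gram_schmidt_step(1)[OF f] by blast
        have "blinfun_apply T v = (\<Sum>l<j. op_form T (f l) v *\<^sub>C blinfun_apply T (f l))" for v
        proof (rule ell2_eqI)
          fix n
          show "cinner (ket n) (blinfun_apply T v)
            = cinner (ket n) (\<Sum>l<j. op_form T (f l) v *\<^sub>C blinfun_apply T (f l))"
            using exp[of "ket n" v]
            by (simp add: cinner.sum_right cinner_scaleC_right) (simp only: op_form_def)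
        qed
        note T = this
        have "range (blinfun_apply T) \<subseteq> ell2.span ((\<lambda>l. blinfun_apply T (f l)) ` {..<j})"
          by (rule image_subsetI, subst T) (intro ell2.span_sum ell2.span_scale ell2.span_base imageI)
        from operator_rank_le_card[OF this]
        have "operator_rank T \<le> enat (card ((\<lambda>l. blinfun_apply T (f l)) ` {..<j}))" by simp
        also have "\<dots> \<le> enat j" using card_image_le[of "{..<j}" "\<lambda>l. blinfun_apply T (f l)"] by simp
        finally show False using k Suc.prems by (meson Suc_le_lessD enat_ord_simps(1) leD order_less_le_trans order_trans)
      qed
      then show ?case using gram_schmidt_step(2)[OF f] by blast
    qed
    then show "\<exists>f. orthonormal k f" by simp
  qed
qed

section \<open>Adjoints\<close>

lemma adjoint_exists:
  assumes "clinear_op T"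
  shows "\<exists>S. \<forall>u v. cinner (blinfun_apply T u) v = cinner u (blinfun_apply S v)"
proof -
  define a where "a v n = cinner (blinfun_apply T (ket n)) v" for v n
  have T_sum: "blinfun_apply T (\<Sum>n<N. c n *\<^sub>C ket n) = (\<Sum>n<N. c n *\<^sub>C blinfun_apply T (ket n))" for c N
    using assms by (simp add: blinfun.sum_right clinear_op_def)
  \<comment> \<open>The test vector \<open>w\<close> carries the first \<open>N\<close> coordinates
    intended for the adjoint at \<open>v\<close>. Pairing the image of \<open>w\<close> with
    \<open>v\<close> returns the squared norm of \<open>w\<close>, and one factor
    \<open>norm w\<close> cancels.\<close>
  have partial: "(\<Sum>n<N. (cmod (a v n))\<^sup>2) \<le> (norm T * norm v)\<^sup>2" for v N
  proof -
    define w where "w = (\<Sum>n<N. a v n *\<^sub>C ket n)"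
    define s where "s = (\<Sum>n<N. (cmod (a v n))\<^sup>2)"
    have s0: "s \<ge> 0" by (simp add: s_def sum_nonneg)
    have "cinner w w = of_real s"
      unfolding s_def of_real_sum
      by (subst w_def) (simp add: cinner.sum_left cinner_scaleC_left w_def cinner_ket_sum
          complex_norm_square mult.commute del: of_real_power)
    then have w: "(norm w)\<^sup>2 = s" by (simp only: cinner_self of_real_eq_iff)
    have "cinner (blinfun_apply T w) v = of_real s"
      unfolding s_def of_real_sum w_def T_sum
      by (simp add: cinner.sum_left cinner_scaleC_left complex_norm_square mult.commute
          del: of_real_power flip: a_def)
    then have "s = cmod (cinner (blinfun_apply T w) v)" using s0 by simp
    also have "\<dots> \<le> norm (blinfun_apply T w) * norm v" by (rule cmod_cinner_le)
    also have "\<dots> \<le> norm T * norm w * norm v" by (intro mult_right_mono norm_blinfun) auto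
    finally have "norm w * norm w \<le> (norm T * norm v) * norm w"
      unfolding w[symmetric] by (simp add: power2_eq_square mult_ac)
    then have "norm w \<le> norm T * norm v"
      by (cases "norm w = 0") (auto simp: mult_le_cancel_right)
    then show ?thesis using w by (metis norm_ge_zero power_mono s_def)
  qed
  have summable: "summable (\<lambda>n. (cmod (a v n))\<^sup>2)" for v
    using partial[of v] by (intro summableI_nonneg_bounded) auto
  define S where "S v = Abs_ell2 (a v)" for v
  have S: "cinner (ket n) (S v) = a v n" for n v
    using summable[of v] by (simp add: S_def cinner_ket_left Abs_ell2_inverse)
  have "bounded_linear S"
  proof (rule bounded_linear_intro)
    show "S (u + v) = S u + S v" for u v
      by (rule ell2_eqI) (simp add: S cinner_add_right a_def)
    show "S (r *\<^sub>R v) = r *\<^sub>R S v" for r v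
      by (rule ell2_eqI) (simp add: S cinner.scaleR_right a_def)
    show "norm (S v) \<le> norm v * norm T" for v
    proof (rule power2_le_imp_le)
      have "(norm (S v))\<^sup>2 = (\<Sum>n. (cmod (a v n))\<^sup>2)" by (simp add: norm_ell2_sq S)
      also have "\<dots> \<le> (norm T * norm v)\<^sup>2"
        by (intro suminf_le_const summable partial)
      finally show "(norm (S v))\<^sup>2 \<le> (norm v * norm T)\<^sup>2" by (simp add: mult.commute)
    qed simp
  qed
  \<comment> \<open>Both sides are continuous in \<open>u\<close> and agree on finite combinations
    of basis vectors.\<close>
  moreover have "cinner (blinfun_apply T u) v = cinner u (S v)" for u v
  proof (rule LIMSEQ_unique)
    let ?u = "\<lambda>N. \<Sum>i<N. cinner (ket i) u *\<^sub>C ket i"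
    show "(\<lambda>N. cinner (blinfun_apply T (?u N)) v) \<longlonglongrightarrow> cinner (blinfun_apply T u) v"
      by (intro bounded_bilinear.tendsto[OF bounded_bilinear_cinner] tendsto_const
          blinfun.tendsto ket_expansion)
    have "(\<lambda>N. cinner (?u N) (S v)) \<longlonglongrightarrow> cinner u (S v)"
      by (intro bounded_bilinear.tendsto[OF bounded_bilinear_cinner] tendsto_const ket_expansion)
    moreover have "cinner (blinfun_apply T (?u N)) v = cinner (?u N) (S v)" for N
      by (simp add: T_sum cinner.sum_left cinner_scaleC_left S a_def)
    ultimately show "(\<lambda>N. cinner (blinfun_apply T (?u N)) v) \<longlonglongrightarrow> cinner u (S v)" by simp
  qed
  ultimately show ?thesis
    by (intro exI[of _ "Blinfun S"]) (simp add: bounded_linear_Blinfun_apply)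
qed

lemma adjoint_operator_eqI:
  assumes "\<And>u v. cinner (blinfun_apply T u) v = cinner u (blinfun_apply S v)"
  shows "adjoint_operator T = S"
  unfolding adjoint_operator_def
proof (rule the_equality)
  fix S' assume S': "\<forall>u v. cinner (blinfun_apply T u) v = cinner u (blinfun_apply S' v)"
  show "S' = S"
    by (rule blinfun_eqI, rule ell2_eqI) (metis S' assms)
qed (use assms in blast)

lemma cinner_adjoint_operator:
  "clinear_op T \<Longrightarrow> cinner (blinfun_apply T u) v = cinner u (blinfun_apply (adjoint_operator T) v)"
  using adjoint_exists adjoint_operator_eqI by metis

section \<open>Rank-one operators\<close>

definition outer :: "ell2 \<Rightarrow> ell2 \<Rightarrow> operator" where
  "outer w v = Blinfun (\<lambda>u. cinner v u *\<^sub>C w)"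

lemma outer_apply [simp]: "blinfun_apply (outer w v) u = cinner v u *\<^sub>C w"
proof -
  have "bounded_linear (\<lambda>u. cinner v u *\<^sub>C w)"
    by (rule bounded_linear_compose[OF bounded_bilinear.bounded_linear_left[OF bounded_bilinear_scaleC]
          bounded_bilinear.bounded_linear_right[OF bounded_bilinear_cinner]])
  then show ?thesis by (simp add: outer_def bounded_linear_Blinfun_apply)
qed

lemma norm_outer_le: "norm (outer w v) \<le> norm w * norm v"
proof (rule norm_blinfun_bound)
  show "norm (blinfun_apply (outer w v) u) \<le> norm w * norm v * norm u" for u
    using mult_left_mono[OF cmod_cinner_le[of v u], of "norm w"] by (simp add: norm_scaleC mult_ac)
qed simp

text \<open>Conjugate-linear in the second argument, hence bilinear over the reals; so sums of
  rank-one operators depend continuously on their vectors.\<close>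

lemma bounded_bilinear_outer: "bounded_bilinear outer"
proof
  show "\<exists>K. \<forall>a b. norm (outer a b) \<le> norm a * norm b * K"
    using norm_outer_le by (intro exI[of _ 1]) simp
qed (rule blinfun_eqI, simp add: blinfun.add_left blinfun.scaleR_left ell2.scale_right_distrib
      ell2.scale_left_distrib cinner_add_left cinner.scaleR_left scaleC_scaleR_comm scaleC_of_real flip: ell2.scale_scale)+

lemma clinear_op_closed:
  "clinear_op S \<Longrightarrow> clinear_op T \<Longrightarrow> clinear_op (S + T)"
  "clinear_op T \<Longrightarrow> clinear_op (r *\<^sub>R T)"
  "clinear_op (outer w v)"
  by (auto simp: clinear_op_def blinfun.add_left blinfun.scaleR_left ell2.scale_right_distrib
      scaleC_scaleR_comm cinner_scaleC_right)

section \<open>Compact operators\<close>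

lemma compact_operatorsI:
  assumes "clinear_op T" "compact S" "\<And>u. norm u \<le> 1 \<Longrightarrow> blinfun_apply T u \<in> S"
  shows "T \<in> compact_operators"
proof -
  have "closure (blinfun_apply T ` cball 0 1) \<subseteq> S"
    using assms(2,3) by (intro closure_minimal compact_imp_closed) auto
  then have "S \<inter> closure (blinfun_apply T ` cball 0 1) = closure (blinfun_apply T ` cball 0 1)" by blast
  then have "compact (closure (blinfun_apply T ` cball 0 1))"
    using compact_Int_closed[OF assms(2) closed_closure] by metis
  then show ?thesis using assms(1) by (simp add: compact_operators_def clinear_op_def)
qed

lemma compact_operatorsE:
  assumes "T \<in> compact_operators"
  obtains S where "compact S" "\<And>u. norm u \<le> 1 \<Longrightarrow> blinfun_apply T u \<in> S"
proof
  show "compact (closure (blinfun_apply T ` cball 0 1))"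
    using assms by (simp add: compact_operators_def)
  show "blinfun_apply T u \<in> closure (blinfun_apply T ` cball 0 1)" if "norm u \<le> 1" for u
    using that closure_subset[of "blinfun_apply T ` cball 0 1"] by auto
qed

lemma compact_operators_add:
  assumes "S \<in> compact_operators" "T \<in> compact_operators"
  shows "S + T \<in> compact_operators"
proof -
  obtain A where A: "compact A" "\<And>u. norm u \<le> 1 \<Longrightarrow> blinfun_apply S u \<in> A"
    using compact_operatorsE[OF assms(1)] by blast
  obtain B where B: "compact B" "\<And>u. norm u \<le> 1 \<Longrightarrow> blinfun_apply T u \<in> B"
    using compact_operatorsE[OF assms(2)] by blast
  show ?thesis
  proof (rule compact_operatorsI)
    show "compact {x + y | x y. x \<in> A \<and> y \<in> B}" using A(1) B(1) by (rule compact_sums)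
  qed (use A B assms in \<open>auto simp: blinfun.add_left clinear_op_closed compact_operators_clinear\<close>)
qed

lemma compact_operators_scaleR:
  assumes "T \<in> compact_operators"
  shows "r *\<^sub>R T \<in> compact_operators"
proof -
  obtain A where A: "compact A" "\<And>u. norm u \<le> 1 \<Longrightarrow> blinfun_apply T u \<in> A"
    using compact_operatorsE[OF assms(1)] by blast
  show ?thesis
  proof (rule compact_operatorsI)
    show "compact ((\<lambda>x. r *\<^sub>R x) ` A)" using A(1) by (rule compact_scaling)
  qed (use A assms in \<open>auto simp: blinfun.scaleR_left clinear_op_closed compact_operators_clinear\<close>)
qed

lemma compact_operators_outer: "outer w v \<in> compact_operators"
proof (rule compact_operatorsI)
  show "compact ((\<lambda>c. c *\<^sub>C w) ` cball 0 (norm v))"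
    by (intro compact_continuous_image continuous_on_scaleC continuous_intros compact_cball)
  show "blinfun_apply (outer w v) u \<in> (\<lambda>c. c *\<^sub>C w) ` cball 0 (norm v)" if "norm u \<le> 1" for u
    using cmod_cinner_le[of v u] mult_left_mono[OF that, of "norm v"] by auto
qed (rule clinear_op_closed)

lemma compact_operators_sum:
  "(\<And>i. i \<in> I \<Longrightarrow> f i \<in> compact_operators) \<Longrightarrow> (\<Sum>i\<in>I. f i) \<in> compact_operators"
proof (induction I rule: infinite_finite_induct)
  case (insert x F)
  then show ?case by (simp add: compact_operators_add)
qed (use compact_operators_scaleR[OF compact_operators_outer, of 0] in auto)

section \<open>Compression to finite corners\<close>

definition coord_proj :: "nat \<Rightarrow> operator" where
  "coord_proj m = (\<Sum>k<m. outer (ket k) (ket k))"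

lemma coord_proj_apply: "blinfun_apply (coord_proj m) u = (\<Sum>k<m. cinner (ket k) u *\<^sub>C ket k)"
  by (simp add: coord_proj_def blinfun.sum_left)

lemma cinner_ket_coord_proj:
  "cinner (ket k) (blinfun_apply (coord_proj m) u) = (if k < m then cinner (ket k) u else 0)"
  by (simp add: coord_proj_apply cinner_ket_sum)

lemma norm_ell2_mono:
  assumes "\<And>k. cmod (cinner (ket k) u) \<le> cmod (cinner (ket k) v)"
  shows "norm u \<le> norm v"
proof (rule power2_le_imp_le)
  show "(norm u)\<^sup>2 \<le> (norm v)\<^sup>2"
    unfolding norm_ell2_sq using assms by (intro suminf_le summable_ell2 power_mono) auto
qed simp

lemma norm_coord_proj: "norm (coord_proj m) \<le> 1"
  by (rule norm_blinfun_bound) (auto intro!: norm_ell2_mono simp: cinner_ket_coord_proj)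

lemma norm_coord_proj_compl: "norm (coord_proj m - id_blinfun) \<le> 1"
  by (rule norm_blinfun_bound)
    (auto intro!: norm_ell2_mono simp: cinner_ket_coord_proj blinfun.diff_left cinner.diff_right)

text \<open>The projections converge strongly to the identity and are uniformly bounded, so
  convergence is uniform on a compact set containing the image of the unit ball; a finite net
  reduces it to finitely many vectors.\<close>

lemma coord_proj_compact_left:
  assumes "T \<in> compact_operators"
  shows "(\<lambda>m. coord_proj m o\<^sub>L T) \<longlonglongrightarrow> T"
proof (rule tendstoI)
  fix e :: real assume "e > 0"
  obtain A where A: "compact A" "\<And>u. norm u \<le> 1 \<Longrightarrow> blinfun_apply T u \<in> A"
    using compact_operatorsE[OF assms] by blast
  then obtain F where F: "finite F" "F \<subseteq> A" "A \<subseteq> (\<Union>x\<in>F. ball x (e / 4))"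
    using seq_compact_imp_totally_bounded[of A] \<open>e > 0\<close> compact_imp_seq_compact
    by (metis divide_pos_pos zero_less_numeral)
  have "\<forall>\<^sub>F m in sequentially. \<forall>x\<in>F. dist (blinfun_apply (coord_proj m) x) x < e / 4"
    unfolding coord_proj_apply
    by (intro eventually_ball_finite F(1) ballI tendstoD ket_expansion) (use \<open>e > 0\<close> in simp)
  then show "\<forall>\<^sub>F m in sequentially. dist (coord_proj m o\<^sub>L T) T < e"
  proof eventually_elim
    case (elim m)
    have unit: "norm (blinfun_apply (coord_proj m) y - y) \<le> e / 2" if "y \<in> A" for y
    proof -
      obtain x where x: "x \<in> F" "dist x y < e / 4" using F(3) \<open>y \<in> A\<close> by auto
      have "blinfun_apply (coord_proj m) y - y
        = blinfun_apply (coord_proj m - id_blinfun) (y - x) + (blinfun_apply (coord_proj m) x - x)"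
        by (simp add: blinfun.diff_left blinfun.diff_right)
      also have "norm \<dots> \<le> norm (blinfun_apply (coord_proj m - id_blinfun) (y - x)) + norm (blinfun_apply (coord_proj m) x - x)"
        by (rule norm_triangle_ineq)
      also have "norm (blinfun_apply (coord_proj m - id_blinfun) (y - x)) \<le> 1 * norm (y - x)"
        by (rule order_trans[OF norm_blinfun mult_right_mono[OF norm_coord_proj_compl]]) simp
      finally show ?thesis using x elim by (auto simp: dist_norm norm_minus_commute)
    qed
    have "norm ((coord_proj m o\<^sub>L T) - T) \<le> e / 2"
    proof (rule norm_blinfun_bound)
      fix u
      show "norm (blinfun_apply ((coord_proj m o\<^sub>L T) - T) u) \<le> e / 2 * norm u"
      proof (cases "u = 0")
        case False
        define w where "w = u /\<^sub>R norm u"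
        have "norm w \<le> 1" "u = norm u *\<^sub>R w" using False by (auto simp: w_def)
        then have "norm (blinfun_apply ((coord_proj m o\<^sub>L T) - T) u)
          = norm u * norm (blinfun_apply (coord_proj m) (blinfun_apply T w) - blinfun_apply T w)"
          by (metis (no_types, lifting) abs_norm_cancel blinfun.diff_left blinfun.scaleR_right blinfun_apply_blinfun_compose norm_scaleR)
        also have "\<dots> \<le> norm u * (e / 2)"
          using unit[OF A(2)[OF \<open>norm w \<le> 1\<close>]] by (intro mult_left_mono) auto
        finally show ?thesis by (simp add: mult.commute)
      qed simp
    qed (use \<open>e > 0\<close> in simp)
    then show ?case using \<open>e > 0\<close> by (simp add: dist_norm)
  qed
qed

lemma norm_le_norm_adjoint:
  assumes "\<And>u v. cinner (blinfun_apply A u) v = cinner u (blinfun_apply A' v)"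
  shows "norm A' \<le> norm A"
proof (rule norm_blinfun_bound)
  fix v
  let ?w = "blinfun_apply A' v"
  have "of_real ((norm ?w)\<^sup>2) = cinner (blinfun_apply A ?w) v"
    by (simp only: cinner_self assms)
  then have "(norm ?w)\<^sup>2 = cmod (cinner (blinfun_apply A ?w) v)"
    by (metis norm_of_real abs_of_nonneg zero_le_power2)
  also have "\<dots> \<le> norm (blinfun_apply A ?w) * norm v" by (rule cmod_cinner_le)
  also have "\<dots> \<le> norm A * norm ?w * norm v" by (intro mult_right_mono norm_blinfun) auto
  finally have "norm ?w * norm ?w \<le> (norm A * norm v) * norm ?w"
    by (simp add: power2_eq_square mult_ac)
  then show "norm ?w \<le> norm A * norm v"
    by (cases "norm ?w = 0") (auto simp: mult_le_cancel_right)
qed simp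

lemma coord_proj_adjoint: "cinner (blinfun_apply (coord_proj m) u) v = cinner u (blinfun_apply (coord_proj m) v)"
  by (simp add: coord_proj_apply cinner.sum_left cinner.sum_right cinner_scaleC_left cinner_scaleC_right
      cinner.hermitian[of u] mult.commute)

text \<open>A positive operator is self-adjoint, so cutting on the right is adjoint to cutting on
  the left and costs no more; the total error is at most twice the one in
  \<open>coord_proj_compact_left\<close>.\<close>

lemma coord_proj_compress:
  assumes "T \<in> compact_operators" "positive_operator T"
  shows "(\<lambda>m. coord_proj m o\<^sub>L T o\<^sub>L coord_proj m) \<longlonglongrightarrow> T"
proof (rule metric_tendsto_imp_tendsto)
  show "(\<lambda>m. 2 *\<^sub>R ((coord_proj m o\<^sub>L T) - T)) \<longlonglongrightarrow> 0"
    using tendsto_scaleR[OF tendsto_const LIM_zero[OF coord_proj_compact_left[OF assms(1)]], of 2] by simp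
  interpret psd_form "op_form T"
    using assms by (intro psd_form_op_form compact_operators_clinear)
  have sa: "cinner (blinfun_apply T u) v = cinner u (blinfun_apply T v)" for u v
    using hermitian[of v u] cinner.hermitian[of "blinfun_apply T u" v] by (simp add: op_form_def)
  have "dist (coord_proj m o\<^sub>L T o\<^sub>L coord_proj m) T \<le> dist (2 *\<^sub>R ((coord_proj m o\<^sub>L T) - T)) 0" for m
  proof -
    let ?P = "coord_proj m"
    have "norm ((T o\<^sub>L ?P) - T) \<le> norm ((?P o\<^sub>L T) - T)"
      by (rule norm_le_norm_adjoint)
        (simp add: blinfun.diff_left cinner.diff_left cinner.diff_right coord_proj_adjoint sa)
    moreover have "norm (?P o\<^sub>L ((T o\<^sub>L ?P) - T)) \<le> 1 * norm ((T o\<^sub>L ?P) - T)"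
      by (rule order_trans[OF norm_blinfun_compose mult_right_mono[OF norm_coord_proj]]) simp
    moreover have eq: "(?P o\<^sub>L T o\<^sub>L ?P) - T = (?P o\<^sub>L ((T o\<^sub>L ?P) - T)) + ((?P o\<^sub>L T) - T)"
      by (rule blinfun_eqI) (simp add: blinfun.diff_left blinfun.diff_right blinfun.add_left)
    have "norm ((?P o\<^sub>L T o\<^sub>L ?P) - T) \<le> norm (?P o\<^sub>L ((T o\<^sub>L ?P) - T)) + norm ((?P o\<^sub>L T) - T)"
      unfolding eq by (rule norm_triangle_ineq)
    ultimately show ?thesis unfolding dist_norm by simp
  qed
  then show "\<forall>\<^sub>F m in sequentially. dist (coord_proj m o\<^sub>L T o\<^sub>L coord_proj m) T
      \<le> dist (2 *\<^sub>R ((coord_proj m o\<^sub>L T) - T)) 0" by simp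
qed

text \<open>One \<open>m\<close> serves all \<open>t\<close> because the image of \<open>a\<close>
  is compact. Compression does not increase the norm of the difference between \<open>a t\<close>
  and a net point, so the error consists of three terms below \<open>e / 4\<close>.\<close>

lemma coord_proj_compress_uniform:
  assumes "a \<in> CK_pos" "e > 0"
  shows "\<exists>m. \<forall>t\<in>{0..1}. norm ((coord_proj m o\<^sub>L a t o\<^sub>L coord_proj m) - a t) < e"
proof -
  define D where "D m T = (coord_proj m o\<^sub>L T o\<^sub>L coord_proj m) - T" for m T
  have cont: "continuous_on {0..1} a" and pos: "\<And>t. t \<in> {0..1} \<Longrightarrow> a t \<in> compact_operators \<and> positive_operator (a t)"
    using assms(1) by (auto simp: CK_pos_def CK_def)
  have "compact (a ` {0..1})" using cont by (rule compact_continuous_image) simp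
  then obtain F where F: "finite F" "F \<subseteq> a ` {0..1}" "a ` {0..1} \<subseteq> (\<Union>x\<in>F. ball x (e / 4))"
    using seq_compact_imp_totally_bounded[of "a ` {0..1}"] assms(2) compact_imp_seq_compact
    by (metis divide_pos_pos zero_less_numeral)
  have "\<forall>\<^sub>F m in sequentially. \<forall>x\<in>F. dist (coord_proj m o\<^sub>L x o\<^sub>L coord_proj m) x < e / 4"
  proof (intro eventually_ball_finite F(1) ballI tendstoD coord_proj_compress)
    fix x assume "x \<in> F"
    then show "x \<in> compact_operators" "positive_operator x" using F(2) pos by auto
  qed (use assms(2) in simp)
  then obtain m where m: "\<And>x. x \<in> F \<Longrightarrow> norm (D m x) < e / 4"
    by (auto simp: eventually_sequentially dist_norm D_def)
  have "norm (D m (a t)) < e" if t: "t \<in> {0..1}" for t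
  proof -
    have "a t \<in> (\<Union>x\<in>F. ball x (e / 4))" using F(3) t by blast
    then obtain x where x: "x \<in> F" "dist x (a t) < e / 4" by auto
    let ?S = "a t - x"
    have "norm (coord_proj m o\<^sub>L ?S o\<^sub>L coord_proj m) \<le> norm (coord_proj m o\<^sub>L ?S) * 1"
      by (rule order_trans[OF norm_blinfun_compose mult_left_mono[OF norm_coord_proj]]) simp
    also have "norm (coord_proj m o\<^sub>L ?S) \<le> 1 * norm ?S"
      by (rule order_trans[OF norm_blinfun_compose mult_right_mono[OF norm_coord_proj]]) simp
    finally have *: "norm (coord_proj m o\<^sub>L ?S o\<^sub>L coord_proj m) \<le> norm ?S" by simp
    have "D m (a t) = D m x + ((coord_proj m o\<^sub>L ?S o\<^sub>L coord_proj m) - ?S)"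
      by (rule blinfun_eqI) (simp add: D_def blinfun.diff_left blinfun.diff_right blinfun.add_left)
    then have "norm (D m (a t)) \<le> norm (D m x) + (norm (coord_proj m o\<^sub>L ?S o\<^sub>L coord_proj m) + norm ?S)"
      by (simp only:) (intro norm_triangle_le add_mono order_refl norm_triangle_ineq4)
    then show ?thesis using * m[OF x(1)] x(2) assms(2) by (simp add: dist_norm norm_minus_commute)
  qed
  then show ?thesis unfolding D_def by blast
qed

section \<open>Cuntz comparison by rank\<close>

lemma gram_dist_op_form:
  assumes "clinear_op T" "positive_operator T"
  shows "psd_form.gram_dist (op_form T) m x A
    = (\<Sum>i<m. \<Sum>j<m. (cmod (cinner (x i) (blinfun_apply T (x j)) - A i j))\<^sup>2)"
  unfolding psd_form.gram_dist_def[OF psd_form_op_form[OF assms]] op_form_def ..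

lemma CK_posD:
  assumes "a \<in> CK_pos"
  shows "continuous_on {0..1} a"
    and "t \<in> {0..1} \<Longrightarrow> a t \<in> compact_operators"
    and "t \<in> {0..1} \<Longrightarrow> clinear_op (a t)"
    and "t \<in> {0..1} \<Longrightarrow> positive_operator (a t)"
proof -
  have a: "continuous_on {0..1} a" "a ` {0..1} \<subseteq> compact_operators" "\<forall>t\<in>{0..1}. positive_operator (a t)"
    using assms by (auto simp: CK_pos_def CK_def)
  show "continuous_on {0..1} a" by (rule a(1))
  assume t: "t \<in> {0..1}"
  then show "a t \<in> compact_operators" using a(2) by blast
  then show "clinear_op (a t)" by (rule compact_operators_clinear)
  show "positive_operator (a t)" using a(3) t by blast
qed

section \<open>From Cuntz comparison to rank comparison\<close>

lemma enat_le_if_below: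
  assumes "\<And>k. enat k \<le> x \<Longrightarrow> enat k \<le> y"
  shows "x \<le> y"
proof (rule ccontr)
  assume "\<not> x \<le> y"
  then obtain n where n: "y = enat n" by (cases y) auto
  then have "enat (Suc n) \<le> x" using \<open>\<not> x \<le> y\<close> by (simp add: not_le Suc_ile_eq)
  then show False using assms[of "Suc n"] n by simp
qed

text \<open>A family orthonormal for \<open>A\<close> is pulled back along the adjoints of
  \<open>r n\<close>. Its Gram matrix for \<open>B\<close> tends to the identity, and the slack in
  \<open>operator_rank_ge_gram\<close> makes one large \<open>n\<close> enough.\<close>

lemma operator_rank_compression_limit:
  assumes pos: "clinear_op A" "positive_operator A" "clinear_op B" "positive_operator B"
    and r: "\<And>n. clinear_op (r n)"
    and lim: "(\<lambda>n. r n o\<^sub>L B o\<^sub>L adjoint_operator (r n)) \<longlonglongrightarrow> A"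
  shows "operator_rank A \<le> operator_rank B"
proof (rule enat_le_if_below)
  fix k assume "enat k \<le> operator_rank A"
  then obtain f where f: "psd_form.orthonormal (op_form A) k f"
    using operator_rank_ge_iff[OF pos(1,2)] by blast
  let ?\<delta> = "\<lambda>i j. if i = j then 1 else 0 :: complex"
  let ?r = "\<lambda>n i. blinfun_apply (adjoint_operator (r n)) (f i)"
  have fA: "cinner (f i) (blinfun_apply A (f j)) = ?\<delta> i j" if "i < k" "j < k" for i j
    using f that psd_form.orthonormal_def[OF psd_form_op_form[OF pos(1,2)]] by (simp add: op_form_def)
  have compress: "cinner (f i) (blinfun_apply (r n o\<^sub>L B o\<^sub>L adjoint_operator (r n)) (f j))
      = cinner (?r n i) (blinfun_apply B (?r n j))" for n i j
    using cinner_adjoint_operator[OF r, of n "blinfun_apply B (?r n j)" "f i"]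
    by (simp add: cinner.hermitian[of "f i"] cinner.hermitian[of "?r n i"])
  have "(\<lambda>n. \<Sum>i<k. \<Sum>j<k. (cmod (cinner (f i)
      (blinfun_apply (r n o\<^sub>L B o\<^sub>L adjoint_operator (r n)) (f j)) - ?\<delta> i j))\<^sup>2)
    \<longlonglongrightarrow> (\<Sum>i<k. \<Sum>j<k. (cmod (cinner (f i) (blinfun_apply A (f j)) - ?\<delta> i j))\<^sup>2)"
    by (intro tendsto_intros bounded_bilinear.tendsto[OF bounded_bilinear_cinner]
        blinfun.tendsto lim)
  then have "(\<lambda>n. \<Sum>i<k. \<Sum>j<k. (cmod (cinner (?r n i) (blinfun_apply B (?r n j)) - ?\<delta> i j))\<^sup>2)
    \<longlonglongrightarrow> 0"
    unfolding compress using fA by simp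
  then have "\<forall>\<^sub>F n in sequentially.
      (\<Sum>i<k. \<Sum>j<k. (cmod (cinner (?r n i) (blinfun_apply B (?r n j)) - ?\<delta> i j))\<^sup>2) < 1"
    by (rule order_tendstoD) simp
  then obtain n where
    "(\<Sum>i<k. \<Sum>j<k. (cmod (cinner (?r n i) (blinfun_apply B (?r n j)) - ?\<delta> i j))\<^sup>2) < 1"
    by (auto dest: eventually_happens)
  then show "enat k \<le> operator_rank B"
    using operator_rank_ge_gram[OF pos(3,4), of k "?r n"] gram_dist_op_form[OF pos(3,4)] by simp
qed

lemma cuntz_le_imp_rank_le:
  assumes "a \<in> CK_pos" "b \<in> CK_pos" "a \<precsim> b" "t \<in> {0..1}"
  shows "operator_rank (a t) \<le> operator_rank (b t)"
proof -
  obtain r where r: "\<And>n. r n \<in> CK"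
    and lim: "uniform_limit {0..1} (\<lambda>n t. r n t o\<^sub>L b t o\<^sub>L adjoint_operator (r n t)) a sequentially"
    using assms(3) unfolding cuntz_le_def by blast
  show ?thesis
  proof (rule operator_rank_compression_limit[where r = "\<lambda>n. r n t"])
    show "clinear_op (r n t)" for n
      using r[of n] assms(4) compact_operators_clinear unfolding CK_def by blast
  qed (use CK_posD assms tendsto_uniform_limitI[OF lim] in auto)
qed

text \<open>A family that is orthonormal for \<open>a t\<close> stays nearly orthonormal for
  \<open>a s\<close> with \<open>s\<close> close to \<open>t\<close>, which still certifies the
  rank.\<close>

lemma operator_rank_lsc:
  assumes a: "a \<in> CK_pos" and t: "t \<in> {0..1}" "enat k \<le> operator_rank (a t)"
  shows "\<exists>d>0. \<forall>s\<in>{0..1}. dist s t < d \<longrightarrow> enat k \<le> operator_rank (a s)"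
proof -
  note aD = CK_posD[OF a]
  obtain f where f: "psd_form.orthonormal (op_form (a t)) k f"
    using operator_rank_ge_iff[OF aD(3,4)[OF t(1)]] t(2) by blast
  let ?\<delta> = "\<lambda>i j. if i = j then 1 else 0 :: complex"
  define G where "G s = (\<Sum>i<k. \<Sum>j<k. (cmod (cinner (f i) (blinfun_apply (a s) (f j)) - ?\<delta> i j))\<^sup>2)" for s
  have "G t = 0"
    using f psd_form.orthonormal_def[OF psd_form_op_form[OF aD(3,4)[OF t(1)]]]
    by (simp add: G_def op_form_def)
  moreover have "continuous_on {0..1} G"
    unfolding G_def
    by (intro continuous_intros continuous_on_cinner blinfun.continuous_on aD)
  ultimately obtain d where d: "d > 0" "\<And>s. s \<in> {0..1} \<Longrightarrow> dist s t < d \<Longrightarrow> dist (G s) 0 < 1"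
    using t(1) unfolding continuous_on_iff by (metis zero_less_one)
  have "enat k \<le> operator_rank (a s)" if "s \<in> {0..1}" "dist s t < d" for s
    using operator_rank_ge_gram[OF aD(3,4)[OF that(1)], of k f] d(2)[OF that]
    by (simp add: gram_dist_op_form[OF aD(3,4)[OF that(1)]] G_def)
  then show ?thesis using d(1) by blast
qed

section \<open>From rank comparison to Cuntz comparison\<close>

lemma gram_tuple_exists:
  fixes m :: nat
  assumes pos: "clinear_op A" "positive_operator A" "clinear_op B" "positive_operator B"
    and le: "operator_rank A \<le> operator_rank B"
  shows "\<exists>x. \<forall>i<m. \<forall>j<m. cinner (x i) (blinfun_apply B (x j)) = cinner (y i) (blinfun_apply A (y j))"
proof -
  interpret A: psd_form "op_form A" using pos(1,2) by (rule psd_form_op_form)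
  interpret B: psd_form "op_form B" using pos(3,4) by (rule psd_form_op_form)
  from A.gram_schmidt[of m y] obtain k f c where f: "A.orthonormal k f"
    and c: "\<forall>i<m. \<forall>w. op_form A w (y i) = (\<Sum>l<k. c i l * op_form A w (f l))"
    by (elim exE conjE)
  have "enat k \<le> operator_rank B"
    using operator_rank_ge_iff[OF pos(1,2)] f le order_trans by blast
  then obtain g where g: "B.orthonormal k g"
    using operator_rank_ge_iff[OF pos(3,4)] by blast
  \<comment> \<open>The coordinates of \<open>y\<close> in an orthonormal family for
    \<open>A\<close> are transplanted to an orthonormal family of the same length for
    \<open>B\<close>, which exists by the rank inequality.\<close>
  define x where "x i = (\<Sum>l<k. c i l *\<^sub>C g l)" for i
  have "op_form B (x i) (x j) = op_form A (y i) (y j)" if ij: "i < m" "j < m" for i j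
  proof -
    have fy: "op_form A (y i) (f l) = cnj (c i l)" if "l < k" for l
    proof -
      have "op_form A (f l) (y i) = (\<Sum>l'<k. c i l' * op_form A (f l) (f l'))"
        using c ij(1) by blast
      also have "\<dots> = (\<Sum>l'<k. if l = l' then c i l' else 0)"
        using f that by (intro sum.cong) (auto simp: A.orthonormal_def)
      finally show ?thesis using that A.hermitian[of "y i" "f l"] by simp
    qed
    have "op_form A (y i) (y j) = (\<Sum>l<k. c j l * op_form A (y i) (f l))"
      using c ij(2) by blast
    also have "\<dots> = (\<Sum>l<k. c j l * cnj (c i l))"
      using fy by simp
    also have "\<dots> = (\<Sum>l<k. \<Sum>l'<k. if l = l' then cnj (c i l) * c j l' else 0)"
      by (simp add: mult.commute)
    also have "\<dots> = (\<Sum>l<k. \<Sum>l'<k. cnj (c i l) * (c j l' * op_form B (g l) (g l')))"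
      using g by (intro sum.cong) (auto simp: B.orthonormal_def)
    also have "\<dots> = op_form B (x i) (x j)"
      unfolding x_def B.sum_left B.scale_left unfolding B.sum_right B.scale_right sum_distrib_left ..
    finally show ?thesis ..
  qed
  then show ?thesis by (auto simp: op_form_def)
qed

text \<open>The approximation problem at a parameter \<open>t\<close> is an open condition on tuples, so it can be
  solved by constant tuples on short intervals; the path lemma \<open>gram_dist_path\<close> allows to pass
  from one constant solution to the next, at the cost of a fixed factor in the error.\<close>

lemma gram_selection:
  fixes m :: nat
  assumes a: "a \<in> CK_pos" and b: "b \<in> CK_pos"
    and le: "\<And>t. t \<in> {0..1} \<Longrightarrow> operator_rank (a t) \<le> operator_rank (b t)"
    and \<eta>: "\<eta> > 0"
  defines "G \<equiv> \<lambda>t z. \<Sum>i<m. \<Sum>j<m. (cmod (cinner (z i) (blinfun_apply (b t) (z j))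
    - cinner (ket i) (blinfun_apply (a t) (ket j))))\<^sup>2"
  shows "\<exists>\<rho>. continuous_on {0..1} \<rho> \<and> (\<forall>t\<in>{0..1}. G t (\<rho> t) < 4 * \<eta>)"
proof -
  note aD = CK_posD[OF a] and bD = CK_posD[OF b]
  have exact: "\<exists>x. \<forall>i<m. \<forall>j<m. cinner (x i) (blinfun_apply (b t) (x j))
      = cinner (ket i) (blinfun_apply (a t) (ket j))" if "t \<in> {0..1}" for t
    using gram_tuple_exists aD(3,4) bD(3,4) le that by blast
  \<comment> \<open>\<open>gram_dist_path\<close> compares with the Gram matrix of a tuple, so both
    tuples are joined to an exact solution \<open>x\<close>.\<close>
  have join: "path_component {z. G t z < 4 * \<eta>} z w"
    if t: "t \<in> {0..1}" and zw: "G t z < \<eta>" "G t w < \<eta>" for t z w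
  proof -
    interpret psd_form "op_form (b t)" using bD t by (intro psd_form_op_form)
    obtain x where x: "\<forall>i<m. \<forall>j<m. cinner (x i) (blinfun_apply (b t) (x j))
      = cinner (ket i) (blinfun_apply (a t) (ket j))" using exact[OF t] by blast
    have G: "gram_dist m z (\<lambda>i j. op_form (b t) (x i) (x j)) = G t z" for z
      using x by (simp add: gram_dist_def G_def op_form_def)
    have "path_component {z. G t z < 4 * \<eta>} z x" if "G t z < \<eta>" for z
      using gram_dist_path[of m z x \<eta>] that unfolding G by simp
    then show ?thesis
      using zw by (meson path_component_sym path_component_trans)
  qed
  have Gcont: "continuous_on S (\<lambda>s. G (f s) (g s))"
    if "continuous_on S f" "f ` S \<subseteq> {0..1}" "\<And>i. continuous_on S (\<lambda>s. g s i)"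
    for S :: "'c::topological_space set" and f g
    unfolding G_def using that
    by (intro continuous_intros continuous_on_cinner blinfun.continuous_on
        continuous_on_compose2[OF aD(1)] continuous_on_compose2[OF bD(1)]) auto
  \<comment> \<open>The error is below \<open>\<eta>\<close> at both ends and below
    \<open>4 * \<eta>\<close> in between, and the starting tuple is arbitrary; hence pieces can be
    concatenated without accumulating loss.\<close>
  define P where "P p q \<longleftrightarrow> (0 \<le> p \<and> p \<le> q \<and> q \<le> 1 \<longrightarrow> (\<forall>z. G p z < \<eta> \<longrightarrow>
    (\<exists>\<rho>. continuous_on {p..q} \<rho> \<and> \<rho> p = z \<and> G q (\<rho> q) < \<eta> \<and> (\<forall>t\<in>{p..q}. G t (\<rho> t) < 4 * \<eta>))))"
    for p q
  have "P 0 1"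
  proof (induction rule: Bolzano[OF zero_le_one])
    case (1 p q r)
    show ?case
      unfolding P_def
    proof (intro impI allI)
      fix z assume pr: "0 \<le> p \<and> p \<le> r \<and> r \<le> 1" and z: "G p z < \<eta>"
      obtain \<rho>1 where \<rho>1: "continuous_on {p..q} \<rho>1" "\<rho>1 p = z" "G q (\<rho>1 q) < \<eta>"
        "\<forall>t\<in>{p..q}. G t (\<rho>1 t) < 4 * \<eta>"
        using 1 pr z unfolding P_def by (metis order_trans)
      obtain \<rho>2 where \<rho>2: "continuous_on {q..r} \<rho>2" "\<rho>2 q = \<rho>1 q" "G r (\<rho>2 r) < \<eta>"
        "\<forall>t\<in>{q..r}. G t (\<rho>2 t) < 4 * \<eta>"
        using 1 pr \<rho>1(3) unfolding P_def by (metis order_trans)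
      have "continuous_on {p..r} (\<lambda>t. if t \<le> q then \<rho>1 t else \<rho>2 t)"
        by (rule continuous_on_cases_le)
          (auto intro: continuous_on_subset[OF \<rho>1(1)] continuous_on_subset[OF \<rho>2(1)] simp: \<rho>2(2))
      then show "\<exists>\<rho>. continuous_on {p..r} \<rho> \<and> \<rho> p = z \<and> G r (\<rho> r) < \<eta> \<and> (\<forall>t\<in>{p..r}. G t (\<rho> t) < 4 * \<eta>)"
        using 1(3,4) \<rho>1 \<rho>2 by (intro exI[of _ "\<lambda>t. if t \<le> q then \<rho>1 t else \<rho>2 t"]) auto
    qed
  next
    case (2 x)
    then have x: "x \<in> {0..1}" by simp
    obtain X where X: "\<forall>i<m. \<forall>j<m. cinner (X i) (blinfun_apply (b x) (X j))
      = cinner (ket i) (blinfun_apply (a x) (ket j))" using exact[OF x] by blast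
    have "G x X = 0" using X by (simp add: G_def)
    moreover have "continuous_on {0..1} (\<lambda>s. G s X)"
      by (rule Gcont) auto
    ultimately obtain d where d: "d > 0"
      "\<And>s. s \<in> {0..1} \<Longrightarrow> dist s x < d \<Longrightarrow> dist (G s X) 0 < \<eta>"
      using x \<eta> unfolding continuous_on_iff by metis
    have "P p q" if pq: "p \<le> x" "x \<le> q" "q - p < d" for p q
      unfolding P_def
    proof (intro impI allI)
      fix z assume pq01: "0 \<le> p \<and> p \<le> q \<and> q \<le> 1" and z: "G p z < \<eta>"
      have GX: "G s X < \<eta>" if "s \<in> {p..q}" for s
      proof -
        have "dist (G s X) 0 < \<eta>"
          using that pq pq01 by (intro d(2)) (auto simp: dist_real_def abs_less_iff)
        then show ?thesis by (simp add: dist_real_def)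
      qed
      show "\<exists>\<rho>. continuous_on {p..q} \<rho> \<and> \<rho> p = z \<and> G q (\<rho> q) < \<eta> \<and> (\<forall>t\<in>{p..q}. G t (\<rho> t) < 4 * \<eta>)"
      proof (cases "p = q")
        case True
        then show ?thesis using z \<eta> by (intro exI[of _ "\<lambda>_. z"]) auto
      next
        case False
        then have "p < q" using pq01 by simp
        \<comment> \<open>The exact solution \<open>X\<close> at \<open>x\<close> serves as a
          constant solution on the whole interval. The switch from \<open>z\<close> to
          \<open>X\<close> happens right after \<open>p\<close>, which requires an interval of
          positive length.\<close>
        have "path_component {z. G p z < 4 * \<eta>} z X"
          using join[of p z X] z GX[of p] pq01 by auto
        then obtain \<gamma> where "path \<gamma>" "path_image \<gamma> \<subseteq> {z. G p z < 4 * \<eta>}"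
          "pathstart \<gamma> = z" "pathfinish \<gamma> = X"
          unfolding path_component_def by blast
        then have \<gamma>: "continuous_on {0..1} \<gamma>" "\<And>u. u \<in> {0..1} \<Longrightarrow> G p (\<gamma> u) < 4 * \<eta>"
          "\<gamma> 0 = z" "\<gamma> 1 = X"
          unfolding path_def path_image_def pathstart_def pathfinish_def by blast+
        have "continuous_on {0..1} (\<lambda>u. G p (\<gamma> u))"
          using continuous_on_product_then_coordinatewise[OF \<gamma>(1)] pq01 by (intro Gcont) auto
        then obtain u0 where u0: "u0 \<in> {0..1}" "\<And>u. u \<in> {0..1} \<Longrightarrow> G p (\<gamma> u) \<le> G p (\<gamma> u0)"
          using continuous_attains_sup[of "{0..1::real}" "\<lambda>u. G p (\<gamma> u)"] by auto
        \<comment> \<open>Compactness of the path leaves a margin \<open>\<epsilon>\<close> below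
          \<open>4 * \<eta>\<close>; moving the parameter away from \<open>p\<close> by at most
          \<open>\<tau>\<close> changes the error by less than this margin.\<close>
        define \<epsilon> where "\<epsilon> = 4 * \<eta> - G p (\<gamma> u0)"
        have \<epsilon>: "\<epsilon> > 0" using \<gamma>(2)[OF u0(1)] by (simp add: \<epsilon>_def)
        let ?\<Phi> = "\<lambda>v :: real \<times> real. G (fst v) (\<gamma> (snd v))"
        have "continuous_on ({p..q} \<times> {0..1}) (\<lambda>v. \<gamma> (snd v))"
          by (rule continuous_on_compose2[OF \<gamma>(1)]) (auto intro!: continuous_intros)
        then have "continuous_on ({p..q} \<times> {0..1}) ?\<Phi>"
          using continuous_on_product_then_coordinatewise pq01
          by (intro Gcont continuous_intros) auto
        then have "uniformly_continuous_on ({p..q} \<times> {0..1}) ?\<Phi>"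
          by (rule compact_uniformly_continuous) (intro compact_Times compact_Icc)
        then obtain \<tau>' where \<tau>': "\<tau>' > 0" "\<And>v w. v \<in> {p..q} \<times> {0..1} \<Longrightarrow> w \<in> {p..q} \<times> {0..1} \<Longrightarrow>
            dist w v < \<tau>' \<Longrightarrow> dist (?\<Phi> w) (?\<Phi> v) < \<epsilon>"
          unfolding uniformly_continuous_on_def using \<epsilon> by metis
        define \<tau> where "\<tau> = min (\<tau>' / 2) (q - p)"
        have \<tau>: "0 < \<tau>" "\<tau> < \<tau>'" "p + \<tau> \<le> q" using \<tau>'(1) \<open>p < q\<close> by (auto simp: \<tau>_def)
        have tube: "G s (\<gamma> u) < 4 * \<eta>" if "s \<in> {p..p + \<tau>}" "u \<in> {0..1}" for s u
        proof -
          have "dist (?\<Phi> (s, u)) (?\<Phi> (p, u)) < \<epsilon>"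
            using that \<tau> pq01 by (intro \<tau>') (auto simp: dist_Pair_Pair dist_real_def)
          then show ?thesis using u0(2)[OF that(2)] by (auto simp: \<epsilon>_def dist_real_def abs_less_iff)
        qed
        \<comment> \<open>The whole path is traversed on \<open>{p..p + \<tau>}\<close>; afterwards
          the tuple rests at \<open>X\<close>.\<close>
        define \<rho> where "\<rho> t = (if t \<le> p + \<tau> then \<gamma> ((t - p) / \<tau>) else X)" for t
        have "continuous_on {p..q} \<rho>"
          unfolding \<rho>_def
        proof (rule continuous_on_cases_le)
          show "continuous_on {t \<in> {p..q}. t \<le> p + \<tau>} (\<lambda>t. \<gamma> ((t - p) / \<tau>))"
            using \<tau> by (intro continuous_on_compose2[OF \<gamma>(1)] continuous_intros) (auto simp: field_simps)
        qed (use \<tau> \<gamma>(4) in \<open>auto intro: continuous_intros\<close>)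
        moreover have "\<rho> p = z" using \<tau> \<gamma>(3) by (simp add: \<rho>_def)
        moreover have "\<rho> q = X" using \<tau> \<gamma>(4) \<open>p < q\<close> by (auto simp: \<rho>_def)
        then have "G q (\<rho> q) < \<eta>" using GX pq01 by simp
        moreover have "G t (\<rho> t) < 4 * \<eta>" if "t \<in> {p..q}" for t
        proof (cases "t \<le> p + \<tau>")
          case True
          then show ?thesis using that tube[of t "(t - p) / \<tau>"] \<tau> by (simp add: \<rho>_def field_simps)
        next
          case False
          then show ?thesis using GX[OF that] \<eta> by (simp add: \<rho>_def)
        qed
        ultimately show ?thesis by blast
      qed
    qed
    then show ?case using d(1) by blast
  qed
  moreover obtain x where "\<forall>i<m. \<forall>j<m. cinner (x i) (blinfun_apply (b 0) (x j))
      = cinner (ket i) (blinfun_apply (a 0) (ket j))" using exact[of 0] by auto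
  then have "G 0 x < \<eta>" using \<eta> by (simp add: G_def)
  ultimately show ?thesis unfolding P_def by force
qed

text \<open>Half of \<open>e\<close> pays for cutting \<open>a\<close> down to a corner of size
  \<open>m\<close>, the other half for matching this corner with the Gram matrix of the selected
  tuples.\<close>

lemma rank_le_imp_cuntz_approx:
  assumes a: "a \<in> CK_pos" and b: "b \<in> CK_pos"
    and le: "\<And>t. t \<in> {0..1} \<Longrightarrow> operator_rank (a t) \<le> operator_rank (b t)"
    and e: "e > 0"
  shows "\<exists>r\<in>CK. \<forall>t\<in>{0..1}. norm ((r t o\<^sub>L b t o\<^sub>L adjoint_operator (r t)) - a t) < e"
proof -
  obtain m where m: "\<And>t. t \<in> {0..1} \<Longrightarrow> norm ((coord_proj m o\<^sub>L a t o\<^sub>L coord_proj m) - a t) < e / 2"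
    using coord_proj_compress_uniform[OF a half_gt_zero[OF e]] by blast
  \<comment> \<open>The \<open>m^2\<close> matrix entries, each with error at most
    \<open>\<delta>\<close>, contribute less than \<open>e / 2\<close> in total; the
    \<open>1\<close> keeps the denominator positive when \<open>m = 0\<close>.\<close>
  define \<delta> where "\<delta> = e / (2 * (real m * real m + 1))"
  have pos: "real m * real m + 1 > 0" by (simp add: add_nonneg_pos)
  have \<delta>: "\<delta> > 0" using e pos by (simp add: \<delta>_def)
  have m\<delta>: "real m * (real m * \<delta>) < e / 2"
  proof -
    have "real m * (real m * \<delta>) = e / 2 * ((real m * real m) / (real m * real m + 1))"
      by (simp add: \<delta>_def)
    also have "\<dots> < e / 2 * 1" using e pos by (intro mult_strict_left_mono) (simp_all add: divide_less_eq)
    finally show ?thesis by simp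
  qed
  define M where "M t z i j = cinner (z i) (blinfun_apply (b t) (z j))
    - cinner (ket i) (blinfun_apply (a t) (ket j))" for t z i j
  \<comment> \<open>The tolerance is a quarter of the target because \<open>gram_selection\<close>
    loses a factor 4.\<close>
  obtain \<rho> where \<rho>: "continuous_on {0..1} \<rho>"
    "\<And>t. t \<in> {0..1} \<Longrightarrow> (\<Sum>i<m. \<Sum>j<m. (cmod (M t (\<rho> t) i j))\<^sup>2) < \<delta>\<^sup>2"
    using gram_selection[OF a b le, of "\<delta>\<^sup>2 / 4" m] \<delta> unfolding M_def by auto
  \<comment> \<open>Compressing \<open>b t\<close> by this \<open>r t\<close> writes the Gram matrix
    of \<open>\<rho> t\<close> into the corner of the first \<open>m\<close> basis vectors.\<close>
  define r where "r t = (\<Sum>i<m. outer (ket i) (\<rho> t i))" for t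
  have "r \<in> CK"
  proof -
    have "continuous_on {0..1} r"
      unfolding r_def using continuous_on_product_then_coordinatewise[OF \<rho>(1)]
      by (intro continuous_intros bounded_bilinear.continuous_on[OF bounded_bilinear_outer]) auto
    moreover have "r t \<in> compact_operators" for t
      unfolding r_def by (intro compact_operators_sum compact_operators_outer)
    ultimately show ?thesis by (auto simp: CK_def)
  qed
  moreover have "norm ((r t o\<^sub>L b t o\<^sub>L adjoint_operator (r t)) - a t) < e" if t: "t \<in> {0..1}" for t
  proof -
    have lin: "blinfun_apply (b t) (c *\<^sub>C u) = c *\<^sub>C blinfun_apply (b t) u"
      "blinfun_apply (a t) (c *\<^sub>C u) = c *\<^sub>C blinfun_apply (a t) u" for c u
      using CK_posD(3)[OF a t] CK_posD(3)[OF b t] by (auto simp: clinear_op_def)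
    have adj: "adjoint_operator (r t) = (\<Sum>i<m. outer (\<rho> t i) (ket i))"
      by (rule adjoint_operator_eqI)
        (simp add: r_def blinfun.sum_left cinner.sum_left cinner.sum_right cinner_scaleC_left
          cinner_scaleC_right cinner.hermitian[of _ "\<rho> t _"] mult.commute)
    let ?d = "(r t o\<^sub>L b t o\<^sub>L adjoint_operator (r t)) - (coord_proj m o\<^sub>L a t o\<^sub>L coord_proj m)"
    have "blinfun_apply (r t o\<^sub>L b t o\<^sub>L adjoint_operator (r t)) u
      = (\<Sum>i<m. \<Sum>j<m. (cinner (ket j) u * cinner (\<rho> t i) (blinfun_apply (b t) (\<rho> t j))) *\<^sub>C ket i)" for u
      unfolding adj by (subst sum.swap) (simp add: r_def blinfun.sum_left blinfun.sum_right lin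
          cinner.sum_right cinner_scaleC_right ell2.scale_sum_left)
    moreover have "blinfun_apply (coord_proj m o\<^sub>L a t o\<^sub>L coord_proj m) u
      = (\<Sum>i<m. \<Sum>j<m. (cinner (ket j) u * cinner (ket i) (blinfun_apply (a t) (ket j))) *\<^sub>C ket i)" for u
      by (subst sum.swap) (simp add: coord_proj_apply blinfun.sum_right lin cinner.sum_right
          cinner_scaleC_right ell2.scale_sum_left)
    ultimately have "?d = (\<Sum>i<m. \<Sum>j<m. outer (M t (\<rho> t) i j *\<^sub>C ket i) (ket j))"
      by (intro blinfun_eqI) (simp only: blinfun.diff_left blinfun.sum_left outer_apply M_def
          ell2.scale_scale ell2.scale_left_diff_distrib[symmetric] right_diff_distrib
          sum_subtractf[symmetric])
    also have "norm \<dots> \<le> (\<Sum>i<m. \<Sum>j<m. \<delta>)"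
    proof (intro norm_sum[THEN order_trans] sum_mono)
      fix i j assume ij: "i \<in> {..<m}" "j \<in> {..<m}"
      have "(cmod (M t (\<rho> t) i j))\<^sup>2 \<le> (\<Sum>j<m. (cmod (M t (\<rho> t) i j))\<^sup>2)"
        using ij by (intro member_le_sum) auto
      also have "\<dots> \<le> (\<Sum>i<m. \<Sum>j<m. (cmod (M t (\<rho> t) i j))\<^sup>2)"
        using ij by (intro member_le_sum[of i _ "\<lambda>i. \<Sum>j<m. (cmod (M t (\<rho> t) i j))\<^sup>2"]) (auto intro: sum_nonneg)
      also have "\<dots> \<le> \<delta>\<^sup>2" using \<rho>(2)[OF t] by simp
      finally have "cmod (M t (\<rho> t) i j) \<le> \<delta>"
        by (rule power2_le_imp_le) (use \<delta> in simp)
      then show "norm (outer (M t (\<rho> t) i j *\<^sub>C ket i) (ket j)) \<le> \<delta>"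
        using norm_outer_le[of "M t (\<rho> t) i j *\<^sub>C ket i" "ket j"] by (simp add: norm_scaleC)
    qed
    also have "\<dots> < e / 2" using m\<delta> by simp
    finally have "norm ?d < e / 2" .
    moreover have "(r t o\<^sub>L b t o\<^sub>L adjoint_operator (r t)) - a t
      = ?d + ((coord_proj m o\<^sub>L a t o\<^sub>L coord_proj m) - a t)" by simp
    then have "norm ((r t o\<^sub>L b t o\<^sub>L adjoint_operator (r t)) - a t)
      \<le> norm ?d + norm ((coord_proj m o\<^sub>L a t o\<^sub>L coord_proj m) - a t)"
      by (simp only: norm_triangle_ineq)
    ultimately show ?thesis using m[OF t] by simp
  qed
  ultimately show ?thesis by blast
qed

theorem cuntz_le_iff_rank_le:
  assumes "a \<in> CK_pos" "b \<in> CK_pos"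
  shows "a \<precsim> b \<longleftrightarrow> (\<forall>t\<in>{0..1}. operator_rank (a t) \<le> operator_rank (b t))"
proof
  assume "\<forall>t\<in>{0..1}. operator_rank (a t) \<le> operator_rank (b t)"
  then have "\<forall>n. \<exists>r\<in>CK. \<forall>t\<in>{0..1}.
      norm ((r t o\<^sub>L b t o\<^sub>L adjoint_operator (r t)) - a t) < inverse (real (Suc n))"
    using rank_le_imp_cuntz_approx[OF assms] by simp
  then obtain r where r: "\<And>n. r n \<in> CK"
    "\<And>n t. t \<in> {0..1} \<Longrightarrow> norm ((r n t o\<^sub>L b t o\<^sub>L adjoint_operator (r n t)) - a t) < inverse (real (Suc n))"
    by metis
  have "uniform_limit {0..1} (\<lambda>n t. r n t o\<^sub>L b t o\<^sub>L adjoint_operator (r n t)) a sequentially"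
  proof (rule uniform_limitI)
    fix e :: real assume "e > 0"
    then obtain N where "inverse (real (Suc N)) < e" using reals_Archimedean by blast
    then have "inverse (real (Suc n)) < e" if "n \<ge> N" for n
      using that by (smt (verit) inverse_positive_iff_positive le_imp_inverse_le of_nat_0_less_iff of_nat_le_iff Suc_le_mono zero_less_Suc)
    then show "\<forall>\<^sub>F n in sequentially. \<forall>t\<in>{0..1}. dist (r n t o\<^sub>L b t o\<^sub>L adjoint_operator (r n t)) (a t) < e"
      using r(2) unfolding eventually_sequentially dist_norm by (meson less_trans)
  qed
  then show "a \<precsim> b" using r(1) unfolding cuntz_le_def by blast
qed (use cuntz_le_imp_rank_le assms in blast)

section \<open>Way-below in terms of rank functions\<close>

lemma cuntz_rel_eq:
  "cuntz_rel = {(a, b). a \<in> CK_pos \<and> b \<in> CK_pos \<and>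
     (\<forall>t\<in>{0..1}. operator_rank (a t) = operator_rank (b t))}"
  unfolding cuntz_rel_def by (auto simp: cuntz_le_iff_rank_le intro: antisym)

lemma class_in_Cu: "a \<in> CK_pos \<Longrightarrow> cuntz_rel `` {a} \<in> Cu"
  unfolding Cu_def by (rule quotientI)

lemma CuE:
  assumes "x \<in> Cu"
  obtains a where "a \<in> CK_pos" "x = cuntz_rel `` {a}"
  using assms unfolding Cu_def by (rule quotientE)

text \<open>All representatives have the same rank at points of the interval, so the image in the
  definition of \<open>rank_fun\<close> is a singleton there and \<open>the_elem\<close> is
  meaningful.\<close>

lemma rank_fun_member:
  assumes "x \<in> Cu" "a \<in> x"
  shows "a \<in> CK_pos" and "t \<in> {0..1} \<Longrightarrow> rank_fun x t = operator_rank (a t)"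
proof -
  obtain b where b: "b \<in> CK_pos" "x = cuntz_rel `` {b}" using assms(1) by (rule CuE)
  show "a \<in> CK_pos" using assms(2) by (simp add: b(2) cuntz_rel_eq)
  assume t: "t \<in> {0..1}"
  have "(\<lambda>a. operator_rank (a t)) ` x = {operator_rank (a t)}"
    using assms(2) t unfolding b(2) cuntz_rel_eq by force
  then show "rank_fun x t = operator_rank (a t)" by (simp add: rank_fun_def)
qed

lemma class_self: "a \<in> CK_pos \<Longrightarrow> a \<in> cuntz_rel `` {a}"
  by (simp add: cuntz_rel_eq)

lemma rank_fun_class:
  "a \<in> CK_pos \<Longrightarrow> t \<in> {0..1} \<Longrightarrow> rank_fun (cuntz_rel `` {a}) t = operator_rank (a t)"
  by (rule rank_fun_member(2)[OF class_in_Cu class_self])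

lemma Cu_le_iff:
  assumes "x \<in> Cu" "y \<in> Cu"
  shows "x \<le>\<^sub>C\<^sub>u y \<longleftrightarrow> (\<forall>t\<in>{0..1}. rank_fun x t \<le> rank_fun y t)"
proof -
  have "a \<precsim> b \<longleftrightarrow> (\<forall>t\<in>{0..1}. rank_fun x t \<le> rank_fun y t)" if "a \<in> x" "b \<in> y" for a b
    using rank_fun_member[OF assms(1) that(1)] rank_fun_member[OF assms(2) that(2)]
    by (simp add: cuntz_le_iff_rank_le)
  moreover have "x \<noteq> {}" "y \<noteq> {}" using assms CuE class_self by blast+
  ultimately show ?thesis unfolding Cu_le_def by blast
qed

lemma rank_fun_lsc:
  assumes "x \<in> Cu" "t \<in> {0..1}" "enat k \<le> rank_fun x t"
  shows "\<exists>d>0. \<forall>s\<in>{0..1}. dist s t < d \<longrightarrow> enat k \<le> rank_fun x s"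
proof -
  obtain a where "a \<in> CK_pos" "x = cuntz_rel `` {a}" using assms(1) by (rule CuE)
  then show ?thesis using operator_rank_lsc[of a t k] assms by (simp add: rank_fun_class)
qed

section \<open>Diagonal elements and their ranks\<close>

lemma inj_ket: "inj ket"
  by (rule injI) (metis cinner_ket_ket zero_neq_one)

text \<open>Basis vectors with nonzero eigenvalue lie in the range. Applied to arbitrarily large
  \<open>S\<close>, this also detects infinite rank.\<close>

lemma operator_rank_ge_eigen:
  assumes "finite S" "\<And>i. i \<in> S \<Longrightarrow> blinfun_apply T (ket i) = l i *\<^sub>R ket i \<and> l i \<noteq> 0"
  shows "enat (card S) \<le> operator_rank T"
proof -
  have inj: "inj_on ket S" using inj_ket by (rule inj_on_subset) simp
  have "enat (card (ket ` S)) \<le> operator_rank T"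
  proof (rule operator_rank_geI)
    show "ell2.independent (ket ` S)"
    proof (rule ell2.independent_if_scalars_zero)
      fix f v assume sum0: "(\<Sum>v\<in>ket ` S. f v *\<^sub>C v) = 0" and "v \<in> ket ` S"
      then obtain i where i: "i \<in> S" "v = ket i" by blast
      have "0 = cinner (ket i) (\<Sum>j\<in>S. f (ket j) *\<^sub>C ket j)"
        using sum0 by (simp add: sum.reindex[OF inj])
      also have "\<dots> = (\<Sum>j\<in>S. if i = j then f (ket j) else 0)"
        unfolding cinner.sum_right cinner_scaleC_right cinner_ket_ket by (intro sum.cong) auto
      finally show "f v = 0" using i assms(1) by simp
    qed (use assms(1) in simp)
    show "ket ` S \<subseteq> range (blinfun_apply T)"
    proof (rule image_subsetI)
      fix i assume "i \<in> S"
      then have "blinfun_apply T ((1 / l i) *\<^sub>R ket i) = ket i"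
        using assms(2)[of i] by (simp add: blinfun.scaleR_right)
      then show "ket i \<in> range (blinfun_apply T)" by (metis rangeI)
    qed
  qed (use assms(1) in simp)
  then show ?thesis by (simp add: card_image[OF inj])
qed

definition diag_op :: "nat \<Rightarrow> (nat \<Rightarrow> real) \<Rightarrow> operator" where
  "diag_op n l = (\<Sum>k<n. l k *\<^sub>R outer (ket k) (ket k))"

lemma diag_op_apply: "blinfun_apply (diag_op n l) u = (\<Sum>k<n. l k *\<^sub>R (cinner (ket k) u *\<^sub>C ket k))"
  by (simp add: diag_op_def blinfun.sum_left blinfun.scaleR_left)

lemma diag_op_ket: "blinfun_apply (diag_op n l) (ket i) = (if i < n then l i *\<^sub>R ket i else 0)"
proof -
  have "blinfun_apply (diag_op n l) (ket i) = (\<Sum>k<n. if i = k then l k *\<^sub>R ket k else 0)"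
    unfolding diag_op_apply cinner_ket_ket by (intro sum.cong) auto
  then show ?thesis by simp
qed

lemma diag_op_compact: "diag_op n l \<in> compact_operators"
  unfolding diag_op_def by (intro compact_operators_sum compact_operators_scaleR compact_operators_outer)

lemma positive_operator_add:
  "positive_operator S \<Longrightarrow> positive_operator T \<Longrightarrow> positive_operator (S + T)"
  by (simp add: positive_operator_def blinfun.add_left cinner_add_right)

lemma positive_operator_scaleR:
  "positive_operator T \<Longrightarrow> 0 \<le> r \<Longrightarrow> positive_operator (r *\<^sub>R T)"
  by (simp add: positive_operator_def blinfun.scaleR_left cinner.scaleR_right complex_nonneg_Reals_iff)

lemma positive_operator_diag_op:
  assumes "\<And>k. k < n \<Longrightarrow> 0 \<le> l k"
  shows "positive_operator (diag_op n l)"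
  unfolding positive_operator_def
proof
  fix u
  have "cinner u (blinfun_apply (diag_op n l) u) = (\<Sum>k<n. of_real (l k * (cmod (cinner (ket k) u))\<^sup>2))"
    unfolding diag_op_apply cinner.sum_right cinner.scaleR_right cinner_scaleC_right of_real_mult
      complex_norm_square
    by (intro sum.cong refl) (simp add: cinner.hermitian[of u])
  also have "\<dots> = of_real (\<Sum>k<n. l k * (cmod (cinner (ket k) u))\<^sup>2)" by simp
  also have "\<dots> \<in> \<real>\<^sub>\<ge>\<^sub>0"
    unfolding nonneg_Reals_of_real_iff using assms by (intro sum_nonneg) auto
  finally show "cinner u (blinfun_apply (diag_op n l) u) \<in> \<real>\<^sub>\<ge>\<^sub>0" .
qed

lemma operator_rank_diag_op: "operator_rank (diag_op n l) = enat (card {k. k < n \<and> l k \<noteq> 0})"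
proof (rule antisym)
  let ?S = "{k. k < n \<and> l k \<noteq> 0}"
  have "blinfun_apply (diag_op n l) u \<in> ell2.span (ket ` ?S)" for u
    unfolding diag_op_apply
  proof (rule ell2.span_sum)
    fix k assume "k \<in> {..<n}"
    then show "l k *\<^sub>R (cinner (ket k) u *\<^sub>C ket k) \<in> ell2.span (ket ` ?S)"
      unfolding scaleR_ell2_def
      by (cases "l k = 0") (auto intro!: ell2.span_scale intro: ell2.span_base ell2.span_zero)
  qed
  then have "operator_rank (diag_op n l) \<le> enat (card (ket ` ?S))"
    by (intro operator_rank_le_card) auto
  also have "\<dots> = enat (card ?S)"
    using inj_on_subset[OF inj_ket] by (simp add: card_image)
  finally show "operator_rank (diag_op n l) \<le> enat (card ?S)" .
  show "enat (card ?S) \<le> operator_rank (diag_op n l)"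
    by (rule operator_rank_ge_eigen[of _ _ l]) (auto simp: diag_op_ket)
qed

lemma diag_op_CK_pos:
  assumes "\<And>k. k < n \<Longrightarrow> continuous_on {0..1} (\<lambda>t. l t k)" "\<And>t k. t \<in> {0..1} \<Longrightarrow> k < n \<Longrightarrow> 0 \<le> l t k"
  shows "(\<lambda>t. diag_op n (l t)) \<in> CK_pos"
proof -
  have "continuous_on {0..1} (\<lambda>t. diag_op n (l t))"
    unfolding diag_op_def using assms(1) by (intro continuous_intros) auto
  then show ?thesis
    using diag_op_compact positive_operator_diag_op assms(2) by (auto simp: CK_pos_def CK_def)
qed

section \<open>A test element with infinite rank off one point\<close>

lift_definition weight :: "ell2 \<Rightarrow> ell2" is "\<lambda>f n. f n / 2 ^ n"
proof (rule summable_comparison_test')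
  fix f :: "nat \<Rightarrow> complex" and n :: nat
  have "cmod (f n / 2 ^ n) \<le> cmod (f n)"
    by (simp add: norm_divide norm_power divide_le_eq mult_le_cancel_left1)
  then show "norm ((cmod (f n / 2 ^ n))\<^sup>2) \<le> (cmod (f n))\<^sup>2"
    by (simp add: power_mono)
qed

definition weight_op :: operator where "weight_op = Blinfun weight"

lemma cinner_ket_weight: "cinner (ket k) (weight u) = cinner (ket k) u / 2 ^ k"
  unfolding cinner_ket_left by transfer simp

lemma weight_op_apply: "blinfun_apply weight_op = weight"
proof -
  have "bounded_linear weight"
  proof (rule bounded_linear_intro)
    show "norm (weight u) \<le> norm u * 1" for u
      unfolding mult_1_right
      by (rule norm_ell2_mono)
        (simp add: cinner_ket_weight norm_divide norm_power divide_le_eq mult_le_cancel_left1)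
  qed (rule ell2_eqI, simp add: cinner_ket_weight cinner_add_right cinner.scaleR_right add_divide_distrib)+
  then show ?thesis unfolding weight_op_def by (rule bounded_linear_Blinfun_apply)
qed

lemma weight_op_ket: "blinfun_apply weight_op (ket i) = (1 / 2 ^ i) *\<^sub>R ket i"
  unfolding weight_op_apply
  by (rule ell2_eqI) (simp add: cinner_ket_weight cinner.scaleR_right cinner_ket_ket)

lemma positive_weight_op: "positive_operator weight_op"
  unfolding positive_operator_def weight_op_apply
proof
  fix u
  have "summable (\<lambda>n. (cmod (Rep_ell2 u n))\<^sup>2 / 2 ^ n)"
  proof (rule summable_comparison_test')
    show "summable (\<lambda>n. (cmod (Rep_ell2 u n))\<^sup>2)" using Rep_ell2[of u] by simp
    show "norm ((cmod (Rep_ell2 u n))\<^sup>2 / 2 ^ n) \<le> (cmod (Rep_ell2 u n))\<^sup>2" for n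
      by (simp add: divide_le_eq mult_le_cancel_left1)
  qed
  then have s: "summable (\<lambda>n. (cmod (Rep_ell2 u n))\<^sup>2 / 2 ^ n)" .
  have "cinner u (weight u) = (\<Sum>n. of_real ((cmod (Rep_ell2 u n))\<^sup>2 / 2 ^ n))"
    unfolding cinner.rep_eq weight.rep_eq of_real_divide complex_norm_square by (simp add: mult.commute)
  also have "\<dots> = of_real (\<Sum>n. (cmod (Rep_ell2 u n))\<^sup>2 / 2 ^ n)"
    by (rule suminf_of_real[OF s, symmetric])
  also have "\<dots> \<in> \<real>\<^sub>\<ge>\<^sub>0"
    unfolding nonneg_Reals_of_real_iff by (intro suminf_nonneg s) simp
  finally show "cinner u (weight u) \<in> \<real>\<^sub>\<ge>\<^sub>0" .
qed

text \<open>The range of the unit ball lies in a Hilbert cube, the continuous image of a product of discs.\<close>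

lemma weight_op_compact: "weight_op \<in> compact_operators"
proof (rule compact_operatorsI)
  show "clinear_op weight_op"
    unfolding clinear_op_def weight_op_apply
    by (intro allI ell2_eqI) (simp add: cinner_ket_weight cinner_scaleC_right)
  define C where "C = PiE UNIV (\<lambda>k::nat. cball (0::complex) (1 / 2 ^ k))"
  have Cbound: "(cmod (c k))\<^sup>2 \<le> (1 / 2) ^ k * (1 / 2) ^ k" if "c \<in> C" for c k
  proof -
    have "cmod (c k) \<le> 1 / 2 ^ k" using that by (auto simp: C_def)
    then have "(cmod (c k))\<^sup>2 \<le> (1 / 2 ^ k)\<^sup>2" by (intro power_mono) auto
    then show ?thesis by (simp add: power2_eq_square power_divide)
  qed
  have geo: "summable (\<lambda>k. (1 / 2 :: real) ^ k)" by (simp add: summable_geometric)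
  have summ: "summable (\<lambda>k. (cmod (c k))\<^sup>2)" if "c \<in> C" for c
  proof (rule summable_comparison_test'[OF geo])
    show "norm ((cmod (c k))\<^sup>2) \<le> (1 / 2) ^ k" for k
      unfolding real_norm_def abs_power2
      by (rule order_trans[OF Cbound[OF that] mult_left_le]) (simp_all add: power_le_one)
  qed
  have coord: "cinner (ket k) (Abs_ell2 c) = c k" if "c \<in> C" for c k
    using summ[OF that] by (simp add: cinner_ket_left Abs_ell2_inverse)
  have "compact C"
    using compactin_PiE[of "\<lambda>_. euclidean" UNIV "\<lambda>k::nat. cball (0::complex) (1 / 2 ^ k)"]
    by (simp add: C_def euclidean_product_topology)
  \<comment> \<open>On the cube the inverse of the coordinate map is a uniform limit of finite
    partial sums: the squared tail from \<open>n\<close> on is at most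
    \<open>2 * (1 / 2) ^ n\<close>.\<close>
  moreover have "continuous_on C Abs_ell2"
  proof (rule uniform_limit_theorem)
    show "\<forall>\<^sub>F n in sequentially. continuous_on C (\<lambda>c. \<Sum>k<n. c k *\<^sub>C ket k)"
      by (intro always_eventually allI continuous_on_sum continuous_on_scaleC continuous_on_const
          continuous_on_subset[OF continuous_on_product_coordinates]) simp
    show "uniform_limit C (\<lambda>n c. \<Sum>k<n. c k *\<^sub>C ket k) Abs_ell2 sequentially"
    proof (rule uniform_limitI)
      fix e :: real assume "e > 0"
      have "(\<lambda>n. 2 * (1 / 2 :: real) ^ n) \<longlonglongrightarrow> 2 * 0"
        by (intro tendsto_mult tendsto_const LIMSEQ_power_zero) simp
      then have "\<forall>\<^sub>F n in sequentially. 2 * (1 / 2 :: real) ^ n < e\<^sup>2"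
        by (rule order_tendstoD(2)) (use \<open>e > 0\<close> in simp)
      then show "\<forall>\<^sub>F n in sequentially. \<forall>c\<in>C. dist (\<Sum>k<n. c k *\<^sub>C ket k) (Abs_ell2 c) < e"
      proof eventually_elim
        case (elim n)
        show ?case
        proof
          fix c assume c: "c \<in> C"
          let ?v = "(\<Sum>k<n. c k *\<^sub>C ket k) - Abs_ell2 c"
          have "(norm ?v)\<^sup>2 = (\<Sum>k. (cmod (cinner (ket k) ?v))\<^sup>2)" by (rule norm_ell2_sq)
          also have "\<dots> \<le> (\<Sum>k. (1 / 2) ^ n * (1 / 2) ^ k)"
          proof (rule suminf_le)
            fix k
            show "(cmod (cinner (ket k) ?v))\<^sup>2 \<le> (1 / 2) ^ n * (1 / 2) ^ k"
            proof (cases "k < n")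
              case True
              then show ?thesis by (simp add: cinner.diff_right cinner_ket_sum coord[OF c])
            next
              case False
              then have "(1 / 2 :: real) ^ k * (1 / 2) ^ k \<le> (1 / 2) ^ n * (1 / 2) ^ k"
                by (intro mult_right_mono power_decreasing) auto
              note order_trans[OF Cbound[OF c] this]
              moreover have "cinner (ket k) ?v = - c k"
                using False by (simp add: cinner.diff_right cinner_ket_sum coord[OF c])
              ultimately show ?thesis by (simp only: norm_minus_cancel)
            qed
          qed (auto intro: summable_ell2 summable_mult geo)
          also have "\<dots> = (1 / 2) ^ n * 2"
            using suminf_mult[OF geo, of "(1 / 2) ^ n"] suminf_geometric[of "1 / 2 :: real"] by simp
          also have "\<dots> < e\<^sup>2" using elim by simp
          finally show "dist (\<Sum>k<n. c k *\<^sub>C ket k) (Abs_ell2 c) < e"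
            using \<open>e > 0\<close> by (simp add: dist_norm power2_less_imp_less)
        qed
      qed
    qed
  qed simp
  ultimately show "compact (Abs_ell2 ` C)" by (intro compact_continuous_image)
  fix u :: ell2 assume u: "norm u \<le> 1"
  have "(\<lambda>k. cinner (ket k) u / 2 ^ k) \<in> C"
  proof -
    have "cmod (cinner (ket k) u) \<le> 1" for k
      using cmod_cinner_le[of "ket k" u] u by simp
    then show ?thesis by (simp add: C_def PiE_UNIV_domain norm_divide norm_power divide_right_mono)
  qed
  moreover from coord[OF this] have "weight u = Abs_ell2 (\<lambda>k. cinner (ket k) u / 2 ^ k)"
    by (intro ell2_eqI) (simp add: cinner_ket_weight)
  ultimately show "blinfun_apply weight_op u \<in> Abs_ell2 ` C" by (simp add: weight_op_apply)
qed

text \<open>Its rank function is the largest one with value \<open>c\<close> at \<open>t0\<close>.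
  So it bounds every sequence of classes whose rank at \<open>t0\<close> is at most
  \<open>c\<close>, which tests suprema at a single point.\<close>

definition spike :: "nat \<Rightarrow> real \<Rightarrow> real \<Rightarrow> operator" where
  "spike c t0 t = diag_op c (\<lambda>_. 1) + \<bar>t - t0\<bar> *\<^sub>R weight_op"

lemma spike_CK_pos: "spike c t0 \<in> CK_pos"
proof -
  have "continuous_on {0..1} (spike c t0)"
    unfolding spike_def by (intro continuous_intros)
  moreover have "spike c t0 t \<in> compact_operators" "positive_operator (spike c t0 t)" for t
    unfolding spike_def
    by (intro compact_operators_add compact_operators_scaleR diag_op_compact weight_op_compact
        positive_operator_add positive_operator_scaleR positive_operator_diag_op positive_weight_op; simp)+
  ultimately show ?thesis by (auto simp: CK_pos_def CK_def)
qed

lemma operator_rank_spike: "operator_rank (spike c t0 t) = (if t = t0 then enat c else \<infinity>)"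
proof (cases "t = t0")
  case True
  then show ?thesis by (simp add: spike_def operator_rank_diag_op)
next
  case False
  have "enat (card {..<n}) \<le> operator_rank (spike c t0 t)" for n :: nat
  proof (rule operator_rank_ge_eigen)
    fix i assume "i \<in> {..<n}"
    have "blinfun_apply (spike c t0 t) (ket i) = ((if i < c then 1 else 0) + \<bar>t - t0\<bar> / 2 ^ i) *\<^sub>R ket i"
      by (simp add: spike_def blinfun.add_left blinfun.scaleR_left diag_op_ket weight_op_ket
          scaleR_left_distrib)
    moreover have "\<bar>t - t0\<bar> / 2 ^ i > 0" using False by simp
    then have "(if i < c then 1 else 0) + \<bar>t - t0\<bar> / 2 ^ i \<noteq> 0"
      by (smt (verit))
    ultimately show "blinfun_apply (spike c t0 t) (ket i)
        = ((if i < c then 1 else 0) + \<bar>t - t0\<bar> / 2 ^ i) *\<^sub>R ket i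
      \<and> (if i < c then 1 else 0) + \<bar>t - t0\<bar> / 2 ^ i \<noteq> 0" by blast
  qed simp
  then have "enat n \<le> operator_rank (spike c t0 t)" for n by simp
  then have "\<infinity> \<le> operator_rank (spike c t0 t)" by (rule enat_le_if_below)
  then show ?thesis using False by simp
qed

section \<open>Way-below, interpolation and local bounds\<close>

lemma way_below_imp_cont_interpolates:
  assumes xy: "x \<in> Cu" "y \<in> Cu" and wb: "x \<lless> y"
  shows "\<exists>g. cont_interpolates (rank_fun x) g (rank_fun y)"
proof -
  \<comment> \<open>the distance to the complement of \<open>{s. Suc k \<le> f\<^sub>y s}\<close>; the point 2 keeps that set nonempty\<close>
  define A where "A k = insert 2 {s \<in> {0..1}. \<not> enat (Suc k) \<le> rank_fun y s}" for k
  define \<delta> where "\<delta> k t = infdist t (A k)" for k t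
  have \<delta>_cont: "continuous_on {0..1} (\<delta> k)" for k
    unfolding \<delta>_def by (intro continuous_intros)
  \<comment> \<open>Lower semicontinuity makes the set where \<open>rank_fun y\<close> reaches
    \<open>Suc k\<close> relatively open, so its points have positive distance from the
    complement.\<close>
  have \<delta>_pos: "\<delta> k t > 0 \<longleftrightarrow> enat (Suc k) \<le> rank_fun y t" if t: "t \<in> {0..1}" for k t
  proof
    assume "\<delta> k t > 0"
    then have "t \<notin> A k" unfolding \<delta>_def using infdist_zero by fastforce
    then show "enat (Suc k) \<le> rank_fun y t" using t by (auto simp: A_def)
  next
    assume "enat (Suc k) \<le> rank_fun y t"
    then obtain d where d: "d > 0" "\<And>s. s \<in> {0..1} \<Longrightarrow> dist s t < d \<Longrightarrow> enat (Suc k) \<le> rank_fun y s"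
      using rank_fun_lsc[OF xy(2) t] by blast
    have "A k \<noteq> {}" by (simp add: A_def)
    \<comment> \<open>The \<open>1\<close> accounts for the extra point 2, which has distance at
      least 1 from the interval.\<close>
    have "min d 1 \<le> infdist t (A k)"
      unfolding infdist_notempty[OF \<open>A k \<noteq> {}\<close>]
    proof (rule cINF_greatest)
      fix s assume "s \<in> A k"
      then consider "s = 2" | "\<not> dist s t < d" using d(2)[of s] unfolding A_def by blast
      then show "min d 1 \<le> dist t s"
        using t by cases (auto simp: dist_real_def)
    qed (simp add: A_def)
    then show "\<delta> k t > 0" using d(1) by (simp add: \<delta>_def min_def split: if_splits)
  qed
  define l where "l n t k = max 0 (\<delta> k t - 1 / real (Suc n))" for n t k
  define a where "a n t = diag_op n (l n t)" for n t
  define z where "z n = cuntz_rel `` {a n}" for n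
  have a: "a n \<in> CK_pos" for n
    unfolding a_def l_def by (intro diag_op_CK_pos continuous_intros \<delta>_cont) simp
  have zCu: "z n \<in> Cu" for n unfolding z_def by (rule class_in_Cu[OF a])
  have rank_z: "rank_fun (z n) t = enat (card {k. k < n \<and> 1 / real (Suc n) < \<delta> k t})"
    if "t \<in> {0..1}" for n t
  proof -
    have "rank_fun (z n) t = enat (card {k. k < n \<and> l n t k \<noteq> 0})"
      using that by (simp add: z_def rank_fun_class[OF a] operator_rank_diag_op a_def del: atLeastAtMost_iff)
    also have "{k. k < n \<and> l n t k \<noteq> 0} = {k. k < n \<and> 1 / real (Suc n) < \<delta> k t}"
      unfolding l_def by (auto simp: max_def)
    finally show ?thesis .
  qed
  have card_le: "enat (card {k. k < n \<and> 0 < \<delta> k t}) \<le> rank_fun y t" if t: "t \<in> {0..1}" for n t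
  proof (cases "rank_fun y t")
    case (enat c)
    then have "{k. k < n \<and> 0 < \<delta> k t} \<subseteq> {..<c}" using \<delta>_pos[OF t] by auto
    then have "card {k. k < n \<and> 0 < \<delta> k t} \<le> c" using card_mono[of "{..<c}"] by simp
    then show ?thesis using enat by simp
  qed simp
  have inc: "Cu_increasing z"
    unfolding Cu_increasing_def Cu_le_iff[OF zCu zCu]
  proof (intro conjI allI ballI zCu)
    fix n and t :: real assume t: "t \<in> {0..1}"
    have "1 / real (Suc (Suc n)) < \<delta> k t" if "1 / real (Suc n) < \<delta> k t" for k
      using that by (rule le_less_trans[rotated]) (simp add: frac_le)
    then show "rank_fun (z n) t \<le> rank_fun (z (Suc n)) t"
      unfolding rank_z[OF t] enat_ord_simps by (intro card_mono) auto
  qed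
  have "Cu_is_sup z y"
    unfolding Cu_is_sup_def
  proof (intro conjI allI ballI impI xy(2))
    fix n
    show "z n \<le>\<^sub>C\<^sub>u y"
      unfolding Cu_le_iff[OF zCu xy(2)]
    proof
      fix t :: real assume t: "t \<in> {0..1}"
      have "1 / real (Suc n) > 0" by simp
      then have "{k. k < n \<and> 1 / real (Suc n) < \<delta> k t} \<subseteq> {k. k < n \<and> 0 < \<delta> k t}"
        using less_trans by blast
      then have "card {k. k < n \<and> 1 / real (Suc n) < \<delta> k t} \<le> card {k. k < n \<and> 0 < \<delta> k t}"
        by (intro card_mono) auto
      then show "rank_fun (z n) t \<le> rank_fun y t"
        unfolding rank_z[OF t] using card_le[OF t, of n] order_trans enat_ord_simps(1) by blast
    qed
  next
    fix w assume w: "w \<in> Cu" "\<forall>n. z n \<le>\<^sub>C\<^sub>u w"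
    show "y \<le>\<^sub>C\<^sub>u w"
      unfolding Cu_le_iff[OF xy(2) w(1)]
    proof
      fix t :: real assume t: "t \<in> {0..1}"
      show "rank_fun y t \<le> rank_fun w t"
      proof (rule enat_le_if_below)
        fix j assume j: "enat j \<le> rank_fun y t"
        have "\<forall>\<^sub>F n in sequentially. \<forall>k\<in>{..<j}. 1 / real (Suc n) < \<delta> k t"
        proof (intro eventually_ball_finite ballI)
          fix k assume "k \<in> {..<j}"
          then have "enat (Suc k) \<le> rank_fun y t"
            using j by (metis Suc_leI enat_ord_simps(1) lessThan_iff order_trans)
          then have "\<delta> k t > 0" using \<delta>_pos[OF t] by simp
          then show "\<forall>\<^sub>F n in sequentially. 1 / real (Suc n) < \<delta> k t"
            using LIMSEQ_inverse_real_of_nat by (intro order_tendstoD(2)[of _ 0]) (auto simp: inverse_eq_divide)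
        qed simp
        then have "\<forall>\<^sub>F n in sequentially. j \<le> n \<and> (\<forall>k\<in>{..<j}. 1 / real (Suc n) < \<delta> k t)"
          by (intro eventually_conj eventually_ge_at_top)
        then obtain n where n: "j \<le> n" "\<forall>k\<in>{..<j}. 1 / real (Suc n) < \<delta> k t"
          by (auto dest: eventually_happens)
        then have "card {..<j} \<le> card {k. k < n \<and> 1 / real (Suc n) < \<delta> k t}"
          by (intro card_mono) auto
        then have "enat j \<le> rank_fun (z n) t" unfolding rank_z[OF t] by simp
        also have "\<dots> \<le> rank_fun w t"
          using w(2) t Cu_le_iff[OF zCu w(1)] by blast
        finally show "enat j \<le> rank_fun w t" .
      qed
    qed
  qed
  moreover have "y \<le>\<^sub>C\<^sub>u y" unfolding Cu_le_iff[OF xy(2) xy(2)] by simp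
  ultimately obtain n where n: "x \<le>\<^sub>C\<^sub>u z n"
    using wb inc unfolding Cu_way_below_def by blast
  \<comment> \<open>The slope \<open>n + 1\<close> makes a summand equal to 1 wherever
    \<open>z n\<close> counts it, so \<open>g\<close> lies above the rank of \<open>z n\<close>. A
    summand is at most 1 and vanishes where \<open>\<delta> k t = 0\<close>, so \<open>g\<close>
    lies below the rank of \<open>y\<close>.\<close>
  define g where "g t = (\<Sum>k<n. min 1 (real (Suc n) * \<delta> k t))" for t
  have \<delta>0: "0 \<le> \<delta> k t" for k t by (simp add: \<delta>_def infdist_nonneg)
  have "continuous_on {0..1} g"
    unfolding g_def by (intro continuous_intros \<delta>_cont)
  moreover have "0 \<le> g t" for t
    unfolding g_def by (intro sum_nonneg) (simp add: \<delta>0)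
  moreover have "ereal_of_enat (rank_fun x t) \<le> ereal (g t) \<and> ereal (g t) \<le> ereal_of_enat (rank_fun y t)"
    if t: "t \<in> {0..1}" for t
  proof
    let ?S = "{k. k < n \<and> 1 / real (Suc n) < \<delta> k t}" and ?T = "{k. k < n \<and> 0 < \<delta> k t}"
    have "rank_fun x t \<le> enat (card ?S)"
      using n t Cu_le_iff[OF xy(1) zCu] rank_z[OF t] by metis
    then have "ereal_of_enat (rank_fun x t) \<le> ereal (real (card ?S))"
      by (metis ereal_of_enat_le_iff ereal_of_enat_simps(1))
    also have "real (card ?S) = (\<Sum>k\<in>?S. min 1 (real (Suc n) * \<delta> k t))"
    proof -
      have "min 1 (real (Suc n) * \<delta> k t) = 1" if "k \<in> ?S" for k
        using that by (simp add: field_simps)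
      then show ?thesis by simp
    qed
    also have "\<dots> \<le> g t"
      unfolding g_def by (intro sum_mono2) (auto simp: \<delta>0)
    finally show "ereal_of_enat (rank_fun x t) \<le> ereal (g t)" by simp
    have "g t = (\<Sum>k\<in>?T. min 1 (real (Suc n) * \<delta> k t))"
      unfolding g_def
    proof (intro sum.mono_neutral_right ballI)
      fix k assume "k \<in> {..<n} - ?T"
      then have "\<delta> k t = 0" using \<delta>0[of k t] by auto
      then show "min 1 (real (Suc n) * \<delta> k t) = 0" by simp
    qed auto
    also have "\<dots> \<le> (\<Sum>k\<in>?T. 1)" by (intro sum_mono) simp
    finally have "ereal (g t) \<le> ereal_of_enat (enat (card ?T))" by simp
    also have "\<dots> \<le> ereal_of_enat (rank_fun y t)" using card_le[OF t] by (simp only: ereal_of_enat_le_iff)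
    finally show "ereal (g t) \<le> ereal_of_enat (rank_fun y t)" .
  qed
  ultimately show ?thesis unfolding cont_interpolates_def by blast
qed

text \<open>\<open>c\<close> is the integer part of \<open>g t\<close>. Near \<open>t\<close> the
  values of \<open>g\<close> lie strictly between \<open>c - 1\<close> and \<open>c + 1\<close>, and
  since \<open>f\<close> and \<open>h\<close> take extended integer values, this sharpens to the
  bound \<open>c\<close> on both sides.\<close>

lemma cont_interpolates_imp_locally_constant:
  assumes "cont_interpolates f g h" "t \<in> {0..1}"
  shows "\<exists>U (c :: nat). rel_open_interval U \<and> t \<in> U \<and> (\<forall>s\<in>U. f s \<le> enat c \<and> enat c \<le> h s)"
proof -
  define c where "c = nat \<lfloor>g t\<rfloor>"
  have g: "continuous_on {0..1} g" "\<And>s. s \<in> {0..1} \<Longrightarrow> 0 \<le> g s"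
    "\<And>s. s \<in> {0..1} \<Longrightarrow> ereal_of_enat (f s) \<le> ereal (g s) \<and> ereal (g s) \<le> ereal_of_enat (h s)"
    using assms(1) by (auto simp: cont_interpolates_def)
  have c: "real c \<le> g t" "g t < real c + 1" using g(2)[OF assms(2)] unfolding c_def by linarith+
  then have "0 < min (real c + 1 - g t) 1" by simp
  then obtain d where d: "d > 0"
    "\<And>s. s \<in> {0..1} \<Longrightarrow> dist s t < d \<Longrightarrow> dist (g s) (g t) < min (real c + 1 - g t) 1"
    using g(1) assms(2) unfolding continuous_on_iff by metis
  let ?U = "{t - d<..<t + d} \<inter> {0..1}"
  have "f s \<le> enat c \<and> enat c \<le> h s" if s: "s \<in> ?U" for s
  proof -
    have "dist (g s) (g t) < min (real c + 1 - g t) 1"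
      using s by (intro d(2)) (auto simp: dist_real_def abs_less_iff)
    then have b: "g s < real c + 1" "real c - 1 < g s" using c by (auto simp: dist_real_def)
    have "f s \<le> enat c"
      using g(3)[of s] s b(1) by (cases "f s") auto
    moreover have "enat c \<le> h s"
      using g(3)[of s] s b(2) by (cases "h s") auto
    ultimately show ?thesis ..
  qed
  moreover have "rel_open_interval ?U" unfolding rel_open_interval_def by blast
  moreover have "t \<in> ?U" using assms(2) d(1) by auto
  ultimately show ?thesis by blast
qed

text \<open>A finite level \<open>c\<close> is reached at \<open>t\<close> by some
  \<open>z n\<close>; lower semicontinuity of \<open>z n\<close> spreads this to a short interval,
  on which \<open>z n\<close> then dominates \<open>x\<close>.\<close>

lemma locally_constant_imp_way_below:
  assumes xy: "x \<in> Cu" "y \<in> Cu"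
    and loc: "\<And>t. t \<in> {0..1} \<Longrightarrow> \<exists>U (c :: nat). rel_open_interval U \<and> t \<in> U \<and>
      (\<forall>s\<in>U. rank_fun x s \<le> enat c \<and> enat c \<le> rank_fun y s)"
  shows "x \<lless> y"
  unfolding Cu_way_below_def
proof (intro allI impI, elim conjE)
  fix z s assume z: "Cu_increasing z" and s: "Cu_is_sup z s" and ys: "y \<le>\<^sub>C\<^sub>u s"
  have zCu: "z n \<in> Cu" for n using z by (simp add: Cu_increasing_def)
  have sCu: "s \<in> Cu" using s by (simp add: Cu_is_sup_def)
  have mono: "rank_fun (z m) t \<le> rank_fun (z n) t" if "m \<le> n" "t \<in> {0..1}" for m n t
    using that(1)
  proof (rule lift_Suc_mono_le[rotated])
    show "rank_fun (z n) t \<le> rank_fun (z (Suc n)) t" for n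
      using z that(2) Cu_le_iff[OF zCu zCu] unfolding Cu_increasing_def by blast
  qed
  \<comment> \<open>If all ranks at \<open>t\<close> were at most \<open>c'\<close>, the predecessor
    of \<open>c\<close>, the spike of height \<open>c'\<close> at \<open>t\<close> would be an upper
    bound of \<open>z\<close>. It would lie above \<open>s\<close>, hence above \<open>y\<close>,
    contradicting \<open>enat c \<le> rank_fun y t\<close>.\<close>
  have attained: "\<exists>n. enat c \<le> rank_fun (z n) t" if t: "t \<in> {0..1}" and c: "enat c \<le> rank_fun y t" for t c
  proof (rule ccontr)
    assume "\<nexists>n. enat c \<le> rank_fun (z n) t"
    then have less: "rank_fun (z n) t < enat c" for n by (simp add: not_le)
    then obtain c' where c': "c = Suc c'" by (cases c) (auto simp: zero_enat_def[symmetric])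
    let ?w = "cuntz_rel `` {spike c' t}"
    have w: "?w \<in> Cu" by (rule class_in_Cu[OF spike_CK_pos])
    have "z n \<le>\<^sub>C\<^sub>u ?w" for n
      unfolding Cu_le_iff[OF zCu w]
    proof
      fix r :: real assume "r \<in> {0..1}"
      then show "rank_fun (z n) r \<le> rank_fun ?w r"
        using less[of n] unfolding rank_fun_class[OF spike_CK_pos \<open>r \<in> {0..1}\<close>] operator_rank_spike c'
        by (cases "rank_fun (z n) r") auto
    qed
    then have "s \<le>\<^sub>C\<^sub>u ?w" using s w unfolding Cu_is_sup_def by blast
    then have "rank_fun s t \<le> enat c'"
      using t unfolding Cu_le_iff[OF sCu w] by (metis rank_fun_class[OF spike_CK_pos] operator_rank_spike)
    moreover have "rank_fun y t \<le> rank_fun s t" using ys t unfolding Cu_le_iff[OF xy(2) sCu] by blast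
    ultimately show False using c c' by (metis Suc_n_not_le_n enat_ord_simps(1) order_trans)
  qed
  \<comment> \<open>One index has to serve a whole interval. Since \<open>z\<close> increases,
    adjacent intervals are joined by taking the larger index, and bisection plays the role of
    compactness.\<close>
  define P where "P p q \<longleftrightarrow> (\<exists>n. \<forall>t\<in>{p..q} \<inter> {0..1}. rank_fun x t \<le> rank_fun (z n) t)" for p q
  have "P 0 1"
  proof (induction rule: Bolzano[OF zero_le_one])
    case (1 p q r)
    then obtain n m where nm: "\<forall>t\<in>{p..q} \<inter> {0..1}. rank_fun x t \<le> rank_fun (z n) t"
      "\<forall>t\<in>{q..r} \<inter> {0..1}. rank_fun x t \<le> rank_fun (z m) t" unfolding P_def by blast
    have "rank_fun x t \<le> rank_fun (z (max n m)) t" if "t \<in> {p..r} \<inter> {0..1}" for t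
    proof (cases "t \<le> q")
      case True
      then have "rank_fun x t \<le> rank_fun (z n) t" using nm(1) that by simp
      then show ?thesis using mono[of n "max n m" t] that by (meson IntD2 max.cobounded1 order_trans)
    next
      case False
      then have "rank_fun x t \<le> rank_fun (z m) t" using nm(2) that by simp
      then show ?thesis using mono[of m "max n m" t] that by (meson IntD2 max.cobounded2 order_trans)
    qed
    then show ?case unfolding P_def by blast
  next
    case (2 t)
    then have t: "t \<in> {0..1}" by simp
    from loc[OF t] obtain U c where U: "rel_open_interval U" "t \<in> U"
      "\<And>s. s \<in> U \<Longrightarrow> rank_fun x s \<le> enat c \<and> enat c \<le> rank_fun y s" by blast
    obtain n where n: "enat c \<le> rank_fun (z n) t" using attained[OF t, of c] U by blast
    obtain d where d: "d > 0" "\<And>s. s \<in> {0..1} \<Longrightarrow> dist s t < d \<Longrightarrow> enat c \<le> rank_fun (z n) s"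
      using rank_fun_lsc[OF zCu t n] by blast
    obtain u v where uv: "U = {u<..<v} \<inter> {0..1}" using U(1) by (auto simp: rel_open_interval_def)
    define e where "e = min d (min (t - u) (v - t))"
    have "e > 0" using d(1) U(2) by (auto simp: e_def uv)
    moreover have "P p q" if "p \<le> t" "t \<le> q" "q - p < e" for p q
      unfolding P_def
    proof (intro exI[of _ n] ballI)
      fix r assume r: "r \<in> {p..q} \<inter> {0..1}"
      have "dist r t < d" "r \<in> U" using r that by (auto simp: dist_real_def uv e_def abs_less_iff)
      then show "rank_fun x r \<le> rank_fun (z n) r" using U(3)[of r] d(2)[of r] r by (meson IntD2 order_trans)
    qed
    ultimately show ?case by blast
  qed
  then obtain n where "\<forall>t\<in>{0..1}. rank_fun x t \<le> rank_fun (z n) t" unfolding P_def by auto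
  then show "\<exists>n. x \<le>\<^sub>C\<^sub>u z n" using Cu_le_iff[OF xy(1) zCu] by blast
qed

text \<open>Failing to interpolate between \<open>rank_fun y\<close> and itself while staying below
  it, \<open>g\<close> is strictly smaller at some point. Strictness persists nearby because
  \<open>g\<close> is continuous and \<open>rank_fun y\<close> is lower semicontinuous.\<close>

lemma cont_interpolates_strict:
  assumes y: "y \<in> Cu" and g: "cont_interpolates f g (rank_fun y)"
    and ne: "\<not> cont_interpolates (rank_fun y) g (rank_fun y)"
  shows "\<exists>U. rel_open_interval U \<and> U \<noteq> {} \<and>
    (\<forall>t\<in>U. ereal_of_enat (f t) \<le> ereal (g t) \<and> ereal (g t) < ereal_of_enat (rank_fun y t))"
proof -
  obtain t where t: "t \<in> {0..1}" "ereal (g t) < ereal_of_enat (rank_fun y t)"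
    using g ne unfolding cont_interpolates_def by (metis not_le)
  \<comment> \<open>A finite level above \<open>g t\<close> and not above the rank at
    \<open>t\<close>, which may be infinite.\<close>
  obtain j :: nat where j: "g t < real j" "enat j \<le> rank_fun y t"
  proof (cases "rank_fun y t")
    case infinity
    then show thesis using reals_Archimedean2[of "g t"] that by auto
  qed (use t(2) that in auto)
  obtain d1 where d1: "d1 > 0" "\<And>s. s \<in> {0..1} \<Longrightarrow> dist s t < d1 \<Longrightarrow> enat j \<le> rank_fun y s"
    using rank_fun_lsc[OF y t(1) j(2)] by blast
  have cont: "continuous_on {0..1} g" using g by (simp add: cont_interpolates_def)
  then obtain d2 where d2: "d2 > 0" "\<And>s. s \<in> {0..1} \<Longrightarrow> dist s t < d2 \<Longrightarrow> dist (g s) (g t) < real j - g t"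
    using t(1) j(1) unfolding continuous_on_iff by (metis diff_gt_0_iff_gt)
  let ?U = "{t - min d1 d2<..<t + min d1 d2} \<inter> {0..1}"
  have "ereal_of_enat (f s) \<le> ereal (g s) \<and> ereal (g s) < ereal_of_enat (rank_fun y s)" if s: "s \<in> ?U" for s
  proof
    have s': "s \<in> {0..1}" "dist s t < d1" "dist s t < d2"
      using s by (auto simp: dist_real_def abs_less_iff)
    show "ereal_of_enat (f s) \<le> ereal (g s)"
      using g s'(1) unfolding cont_interpolates_def by blast
    have "g s < real j" using d2(2)[OF s'(1,3)] by (auto simp: dist_real_def)
    then have "ereal (g s) < ereal_of_enat (enat j)" by simp
    also have "\<dots> \<le> ereal_of_enat (rank_fun y s)" using d1(2)[OF s'(1,2)] by (simp only: ereal_of_enat_le_iff)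
    finally show "ereal (g s) < ereal_of_enat (rank_fun y s)" .
  qed
  moreover have "rel_open_interval ?U" unfolding rel_open_interval_def by blast
  moreover have "t \<in> ?U" using t(1) d1(1) d2(1) by auto
  ultimately show ?thesis by blast
qed

lemma way_below_iff_cont_interpolates:
  assumes "x \<in> Cu" "y \<in> Cu"
  shows "x \<lless> y \<longleftrightarrow> (\<exists>g. cont_interpolates (rank_fun x) g (rank_fun y))"
  using way_below_imp_cont_interpolates[OF assms] locally_constant_imp_way_below[OF assms]
    cont_interpolates_imp_locally_constant by blast

lemma Cu_le_trans:
  "x \<in> Cu \<Longrightarrow> y \<in> Cu \<Longrightarrow> z \<in> Cu \<Longrightarrow> x \<le>\<^sub>C\<^sub>u y \<Longrightarrow> y \<le>\<^sub>C\<^sub>u z \<Longrightarrow> x \<le>\<^sub>C\<^sub>u z"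
  by (simp add: Cu_le_iff) (meson order_trans)

text \<open>Pure order theory: compactness is applied to the given sequence, either for
  \<open>x\<close>, which lies below \<open>s\<close> by transitivity, or for \<open>y\<close>,
  followed by transitivity.\<close>

lemma way_below_if_compact:
  assumes "x \<in> Cu" "y \<in> Cu" "Cu_compact x \<or> Cu_compact y" "x \<le>\<^sub>C\<^sub>u y"
  shows "x \<lless> y"
  unfolding Cu_way_below_def
proof (intro allI impI, elim conjE)
  fix z s assume z: "Cu_increasing z" and s: "Cu_is_sup z s" and ys: "y \<le>\<^sub>C\<^sub>u s"
  have Cu: "s \<in> Cu" "\<And>n. z n \<in> Cu" using z s by (auto simp: Cu_increasing_def Cu_is_sup_def)
  from assms(3) show "\<exists>n. x \<le>\<^sub>C\<^sub>u z n"
  proof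
    assume "Cu_compact x"
    moreover have "x \<le>\<^sub>C\<^sub>u s" using Cu_le_trans[OF assms(1,2) Cu(1) assms(4) ys] .
    ultimately show ?thesis using z s unfolding Cu_compact_def Cu_way_below_def by blast
  next
    assume "Cu_compact y"
    then obtain n where "y \<le>\<^sub>C\<^sub>u z n"
      using z s ys unfolding Cu_compact_def Cu_way_below_def by blast
    then show ?thesis using Cu_le_trans[OF assms(1,2) Cu(2) assms(4)] by blast
  qed
qed

theorem proposition3p5:
  fixes x y :: cuntz_class
  assumes "x \<in> Cu" and "y \<in> Cu"
  shows
    "(x \<lless> y \<longleftrightarrow>
        (\<forall>t\<in>{0..1}. \<exists>U (c :: nat). rel_open_interval U \<and> t \<in> U \<and>
           (\<forall>s\<in>U. rank_fun x s \<le> enat c \<and> enat c \<le> rank_fun y s)))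
     \<and> (x \<lless> y \<longleftrightarrow> (\<exists>g. cont_interpolates (rank_fun x) g (rank_fun y)))
     \<and> (Cu_compact x \<or> Cu_compact y \<longrightarrow>
          (x \<lless> y \<longleftrightarrow> (\<forall>t\<in>{0..1}. rank_fun x t \<le> rank_fun y t)))
     \<and> (\<not> Cu_compact y \<longrightarrow> x \<lless> y \<longrightarrow>
          (\<exists>g U. cont_interpolates (rank_fun x) g (rank_fun y) \<and>
             rel_open_interval U \<and> U \<noteq> {} \<and>
             (\<forall>t\<in>U. ereal_of_enat (rank_fun x t) \<le> ereal (g t) \<and>
                     ereal (g t) < ereal_of_enat (rank_fun y t))))"
proof (intro conjI impI)
  show "x \<lless> y \<longleftrightarrow> (\<forall>t\<in>{0..1}. \<exists>U (c :: nat). rel_open_interval U \<and> t \<in> U \<and>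
           (\<forall>s\<in>U. rank_fun x s \<le> enat c \<and> enat c \<le> rank_fun y s))"
    using way_below_imp_cont_interpolates[OF assms] locally_constant_imp_way_below[OF assms]
      cont_interpolates_imp_locally_constant by blast
  show iff: "x \<lless> y \<longleftrightarrow> (\<exists>g. cont_interpolates (rank_fun x) g (rank_fun y))"
    by (rule way_below_iff_cont_interpolates[OF assms])
  show "x \<lless> y \<longleftrightarrow> (\<forall>t\<in>{0..1}. rank_fun x t \<le> rank_fun y t)" if "Cu_compact x \<or> Cu_compact y"
  proof
    assume "x \<lless> y"
    then obtain g where g: "cont_interpolates (rank_fun x) g (rank_fun y)" using iff by blast
    show "\<forall>t\<in>{0..1}. rank_fun x t \<le> rank_fun y t"
      using g unfolding cont_interpolates_def by (metis ereal_of_enat_le_iff order_trans)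
  next
    assume "\<forall>t\<in>{0..1}. rank_fun x t \<le> rank_fun y t"
    then have "x \<le>\<^sub>C\<^sub>u y" by (simp add: Cu_le_iff[OF assms])
    then show "x \<lless> y" by (rule way_below_if_compact[OF assms that])
  qed
  assume "\<not> Cu_compact y" "x \<lless> y"
  then obtain g where g: "cont_interpolates (rank_fun x) g (rank_fun y)" using iff by blast
  \<comment> \<open>Otherwise \<open>g\<close> would witness that \<open>y\<close> is way below
    itself, that is, compact.\<close>
  have "\<not> cont_interpolates (rank_fun y) g (rank_fun y)"
    using \<open>\<not> Cu_compact y\<close> way_below_iff_cont_interpolates[OF assms(2,2)]
    unfolding Cu_compact_def by blast
  from cont_interpolates_strict[OF assms(2) g this]
  show "\<exists>g U. cont_interpolates (rank_fun x) g (rank_fun y) \<and>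
             rel_open_interval U \<and> U \<noteq> {} \<and>
             (\<forall>t\<in>U. ereal_of_enat (rank_fun x t) \<le> ereal (g t) \<and>
                     ereal (g t) < ereal_of_enat (rank_fun y t))"
    using g by blast
qed

end
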